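(* Let $u_0,\eta_0\in C^1_b(\mathbb{R}^+)$ and $h\in C^2_b(\mathbb{R}^+)$ satisfy $$h(x)\ge 0,\qquad h'(x)\le 0,\qquad h''(x)\ge 0,\qquad x\in\mathbb{R}^+,$$ and, for a fixed constant $C>0$, $$\eta_0(x)\ge C,\qquad u_0(x)\le -2\sqrt{h(x)+\eta_0(x)},\qquad u_0'(x)\ge\frac{|h'(x)+\eta_0'(x)|}{\sqrt{h(x)+\eta_0(x)}},\qquad x\in\mathbb{R}^+.$$ Then, for every $T>0$, there exists a unique classical solution $u,\eta\in C^{1,1}(\Omega_T)$ of the shallow-water system $$\partial_t\eta+\partial_x\left[u(h(x)+\eta)\right]=0,\qquad \partial_t u+u\,\partial_x u+\partial_x\eta=0$$ in $\Omega_T$ such that $u|_{t=0}=u_0$ and $\eta|_{t=0}=\eta_0$. (No boundary condition is imposed at $x=0$.)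
   Context: $\mathbb{R}^+=[0,\infty)$. $C^n_b(\mathbb{R}^+)$ is the space of functions on $\mathbb{R}^+$ with bounded and continuous derivatives up to order $n$. For $T>0$, $\Omega_T:=\{(t,x): t\in(0,T),\ x\in\mathbb{R}^+\}$, and $C^{1,1}(\Omega_T)$ is the space of bounded functions on $\Omega_T$ that are continuously differentiable in $t$ and $x$ with bounded first derivatives (derivatives in $x$ at $x=0$ are one-sided). Initial conditions are understood for the continuous extension to $t=0$. The gravitational constant is normalized to $g=1$. *)

theory Defs
  imports "HOL-Analysis.Analysis"
begin

text \<open>
  Functions on \<open>[0,\<infinity>)\<close> are represented by total functions on the reals whose values at negative
  arguments are irrelevant.  The derivative is taken within \<open>[0,\<infinity>)\<close>, hence is one-sided at \<open>0\<close>.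
\<close>

definition hderiv :: "(real \<Rightarrow> real) \<Rightarrow> real \<Rightarrow> real" where
  "hderiv f x = vector_derivative f (at x within {0..})"

definition Cb :: "nat \<Rightarrow> (real \<Rightarrow> real) set" where
  "Cb n = {f.
     (\<forall>k<n. \<forall>x\<ge>0. (hderiv ^^ k) f differentiable (at x within {0..})) \<and>
     (\<forall>k\<le>n. continuous_on {0..} ((hderiv ^^ k) f) \<and> bounded ((hderiv ^^ k) f ` {0..}))}"

definition Omega :: "real \<Rightarrow> (real \<times> real) set" where
  "Omega T = {0<..<T} \<times> {0..}"

definition pt :: "(real \<Rightarrow> real \<Rightarrow> real) \<Rightarrow> real \<Rightarrow> real \<Rightarrow> real" where
  "pt f t x = deriv (\<lambda>s. f s x) t"

definition px :: "(real \<Rightarrow> real \<Rightarrow> real) \<Rightarrow> real \<Rightarrow> real \<Rightarrow> real" where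
  "px f t x = hderiv (f t) x"

text \<open>Continuity of the partial derivatives is joint continuity in \<open>(t,x)\<close>.\<close>

definition C11 :: "real \<Rightarrow> (real \<Rightarrow> real \<Rightarrow> real) set" where
  "C11 T = {f.
     (\<forall>(t, x) \<in> Omega T. (\<lambda>s. f s x) differentiable (at t)
                        \<and> f t differentiable (at x within {0..})) \<and>
     continuous_on (Omega T) (\<lambda>(t, x). pt f t x) \<and>
     continuous_on (Omega T) (\<lambda>(t, x). px f t x) \<and>
     bounded ((\<lambda>(t, x). f t x) ` Omega T) \<and>
     bounded ((\<lambda>(t, x). pt f t x) ` Omega T) \<and>
     bounded ((\<lambda>(t, x). px f t x) ` Omega T)}"

text \<open>
  Functions in \<open>C11 T\<close> are only constrained on \<open>Omega T\<close>, which excludes \<open>t = 0\<close>; the initial value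
  is that of the continuous extension, not the value \<open>f 0\<close> of the representing total function.
\<close>

definition has_initial_value ::
    "real \<Rightarrow> (real \<Rightarrow> real \<Rightarrow> real) \<Rightarrow> (real \<Rightarrow> real) \<Rightarrow> bool" where
  "has_initial_value T f f0 \<longleftrightarrow>
     (\<exists>g. continuous_on ({0..<T} \<times> {0..}) (\<lambda>(t, x). g t x) \<and>
          (\<forall>(t, x) \<in> Omega T. g t x = f t x) \<and>
          (\<forall>x\<ge>0. g 0 x = f0 x))"

definition shallow_water_solution ::
    "(real \<Rightarrow> real) \<Rightarrow> (real \<Rightarrow> real) \<Rightarrow> (real \<Rightarrow> real) \<Rightarrow> real
      \<Rightarrow> (real \<Rightarrow> real \<Rightarrow> real) \<Rightarrow> (real \<Rightarrow> real \<Rightarrow> real) \<Rightarrow> bool" where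
  "shallow_water_solution h u0 \<eta>0 T u \<eta> \<longleftrightarrow>
     u \<in> C11 T \<and> \<eta> \<in> C11 T \<and>
     (\<forall>(t, x) \<in> Omega T.
        pt \<eta> t x + px (\<lambda>t x. u t x * (h x + \<eta> t x)) t x = 0 \<and>
        pt u t x + u t x * px u t x + px \<eta> t x = 0) \<and>
     has_initial_value T u u0 \<and> has_initial_value T \<eta> \<eta>0"

end

theory Submission
  imports Defs
begin

text \<open>
  With \<open>c = sqrt (h + \<eta>)\<close>, the Riemann invariants \<open>z\<^sub>\<plusminus> = u \<plusminus> 2 c\<close> solve the diagonal system
  \<open>\<partial>\<^sub>t z\<^sub>\<plusminus> + (u \<plusminus> c) \<partial>\<^sub>x z\<^sub>\<plusminus> = h'\<close>. The hypotheses say that initially \<open>z\<^sub>\<plusminus> \<le> 0\<close> and \<open>\<partial>\<^sub>x z\<^sub>\<plusminus> \<ge> 0\<close>.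
  Since \<open>h' \<le> 0\<close> and \<open>h'' \<ge> 0\<close>, both signs persist: all characteristics leave through \<open>x = 0\<close>, so that
  no boundary condition is needed, and there is no steepening, so that \<open>\<partial>\<^sub>x z\<^sub>\<plusminus>\<close> grows at most linearly
  in time. An explicit semi-Lagrangian scheme inherits these bounds. Its approximations with
  steps \<open>d / 2\<^sup>n\<close> form a Cauchy sequence, and since their slopes have a common modulus of continuity, the
  limit is continuously differentiable.

  Positivity of \<open>c\<close> and uniqueness follow from a maximum principle for transport equations with
  outgoing speeds. For uniqueness the difference of the two solutions is linearised around the constructed
  one, so nothing has to be known about the sign of the depth or the speeds of the other solution.
\<close>

section \<open>Global solutions of the diagonal system\<close>

text \<open>The system is quasilinear and the time interval is arbitrary, whereas a contraction
  argument would by itself give only a short time; an explicit scheme can carry the sign conditions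
  through every step. What makes this easy is that each speed u \<plusminus> c is a weighted mean,
  with weights 3/4 and 1/4, of the two invariants: signs, bounds and sup distances pass from the
  invariants to the speeds without loss. The data and the source h' are only once differentiable, so
  no second derivatives are available to control the slopes. Values therefore converge at first
  order in the step, while slopes converge without a rate and only locally uniformly in x, being
  recovered from difference quotients of fixed width. The invariants are constructed without knowing
  that c > 0, since the diagonal system and \<eta> = c^2 - h are polynomial in them. The lower bound
  on c enters in the uniqueness proof, where the difference w of the velocities has to be recovered
  from c w.\<close>

lemma half_line_mvt:
  fixes f f' :: "real \<Rightarrow> real"
  assumes "\<And>x. x \<ge> 0 \<Longrightarrow> (f has_real_derivative f' x) (at x within {0..})" "x \<ge> 0" "y \<ge> 0"
  obtains \<xi> where "min x y \<le> \<xi>" "\<xi> \<le> max x y" "f y - f x = f' \<xi> * (y - x)"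
proof -
  have *: "\<exists>\<xi>. a \<le> \<xi> \<and> \<xi> \<le> b \<and> f b - f a = f' \<xi> * (b - a)" if "0 \<le> a" "a < b" for a b
  proof -
    have "(f has_derivative (*) (f' t)) (at t within {a..b})" if "a \<le> t" "t \<le> b" for t
      using assms(1)[of t] that \<open>0 \<le> a\<close> unfolding has_field_derivative_def
      by (auto intro: has_derivative_subset)
    from mvt_simple[OF \<open>a < b\<close> this] obtain \<xi> where "\<xi> \<in> {a<..<b}" "f b - f a = f' \<xi> * (b - a)"
      by auto
    then show ?thesis by (intro exI[of _ \<xi>]) auto
  qed
  consider "x < y" | "y < x" | "x = y" by linarith
  then show thesis
  proof cases
    case 1 then show ?thesis using *[of x y] assms that by (auto simp: min_def max_def)
  next
    case 2
    then obtain \<xi> where "y \<le> \<xi>" "\<xi> \<le> x" "f x - f y = f' \<xi> * (x - y)" using *[of y x] assms by auto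
    then show ?thesis using 2 that[of \<xi>] by (auto simp: min_def max_def algebra_simps)
  next
    case 3 then show ?thesis using that[of x] by auto
  qed
qed

section \<open>Characteristic speeds as weighted means of the invariants\<close>

definition wave_speed :: "(bool \<Rightarrow> real) \<Rightarrow> bool \<Rightarrow> real" where
  "wave_speed a i = (2 * a i + a True + a False) / 4"

lemma wave_speed_le:
  assumes "\<And>j. a j \<le> b"
  shows "wave_speed a i \<le> b"
  using assms[of i] assms[of True] assms[of False] by (simp add: wave_speed_def)

lemma wave_speed_ge:
  assumes "\<And>j. b \<le> a j"
  shows "b \<le> wave_speed a i"
  using assms[of i] assms[of True] assms[of False] by (simp add: wave_speed_def)

lemma wave_speed_dist_le:
  assumes "\<And>j. \<bar>a j - b j\<bar> \<le> e"
  shows "\<bar>wave_speed a i - wave_speed b i\<bar> \<le> e"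
proof -
  have "wave_speed a i - wave_speed b i = wave_speed (\<lambda>j. a j - b j) i"
    by (simp add: wave_speed_def field_simps)
  moreover have "wave_speed (\<lambda>j. a j - b j) i \<le> e" "- e \<le> wave_speed (\<lambda>j. a j - b j) i"
    using assms by (auto intro!: wave_speed_le wave_speed_ge simp: abs_le_iff) (metis minus_diff_eq neg_le_iff_le)
  ultimately show ?thesis by linarith
qed

lemma wave_speed_has_real_derivative:
  assumes "\<And>j. ((\<lambda>x. a x j) has_real_derivative a' j) (at t within X)"
  shows "((\<lambda>x. wave_speed (a x) i) has_real_derivative wave_speed a' i) (at t within X)"
  unfolding wave_speed_def
  by (auto intro!: derivative_eq_intros assms)

lemma abs_triangle3_le:
  fixes a b c :: real
  assumes "\<bar>a\<bar> \<le> x" "\<bar>b\<bar> \<le> y" "\<bar>c\<bar> \<le> z"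
  shows "\<bar>a + b + c\<bar> \<le> x + y + z"
  using assms by linarith

text \<open>\<open>F\<close> stands for h' and \<open>F'\<close> for h''. \<open>S\<close> is the
  time horizon; \<open>A\<close>, \<open>B\<close>, \<open>Z\<close> and \<open>P\<close> bound the
  source, its slope, the data and their slopes.\<close>

locale diagonal_system =
  fixes F F' :: "real \<Rightarrow> real" and z0 p0 :: "bool \<Rightarrow> real \<Rightarrow> real" and S A B Z P :: real
  assumes S_pos: "S > 0"
    and F_deriv: "\<And>x. x \<ge> 0 \<Longrightarrow> (F has_real_derivative F' x) (at x within {0..})"
    and F_bounds: "\<And>x. x \<ge> 0 \<Longrightarrow> - A \<le> F x" "\<And>x. x \<ge> 0 \<Longrightarrow> F x \<le> 0"
    and F'_bounds: "\<And>x. x \<ge> 0 \<Longrightarrow> 0 \<le> F' x" "\<And>x. x \<ge> 0 \<Longrightarrow> F' x \<le> B"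
    and F'_cont: "continuous_on {0..} F'"
    and z0_deriv: "\<And>i x. x \<ge> 0 \<Longrightarrow> (z0 i has_real_derivative p0 i x) (at x within {0..})"
    and z0_bounds: "\<And>i x. x \<ge> 0 \<Longrightarrow> - Z \<le> z0 i x" "\<And>i x. x \<ge> 0 \<Longrightarrow> z0 i x \<le> 0"
    and p0_bounds: "\<And>i x. x \<ge> 0 \<Longrightarrow> 0 \<le> p0 i x" "\<And>i x. x \<ge> 0 \<Longrightarrow> p0 i x \<le> P"
    and p0_cont: "\<And>i. continuous_on {0..} (p0 i)"
begin

lemma const_nonneg: "A \<ge> 0" "B \<ge> 0" "Z \<ge> 0" "P \<ge> 0"
  using F_bounds[of 0] F'_bounds[of 0] z0_bounds[of 0 True] p0_bounds[of 0 True] by auto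

text \<open>Semi-Lagrangian scheme with time step \<open>d\<close>: the characteristic through \<open>x\<close> is replaced by a straight
  line of slope frozen at \<open>x\<close>, and \<open>ps d k i\<close> is the spatial derivative of \<open>zs d k i\<close>. As the data are
  nondecreasing, \<open>foot\<close> is nondecreasing and nonexpansive once \<open>d * M \<le> 1\<close>; therefore slopes are amplified
  only by the source term, and the bounds hold on the whole time interval \<open>[0, S]\<close>.\<close>

primrec zs :: "real \<Rightarrow> nat \<Rightarrow> bool \<Rightarrow> real \<Rightarrow> real" where
  "zs d 0 = z0"
| "zs d (Suc k) = (\<lambda>i x. zs d k i (x - d * wave_speed (\<lambda>j. zs d k j x) i) + d * F x)"

definition foot :: "real \<Rightarrow> nat \<Rightarrow> bool \<Rightarrow> real \<Rightarrow> real" where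
  "foot d k i x = x - d * wave_speed (\<lambda>j. zs d k j x) i"

primrec ps :: "real \<Rightarrow> nat \<Rightarrow> bool \<Rightarrow> real \<Rightarrow> real" where
  "ps d 0 = p0"
| "ps d (Suc k) =
     (\<lambda>i x. ps d k i (foot d k i x) * (1 - d * wave_speed (\<lambda>j. ps d k j x) i) + d * F' x)"

lemma zs_Suc: "zs d (Suc k) i x = zs d k i (foot d k i x) + d * F x"
  by (simp add: foot_def)

text \<open>Bounds over the whole of [0, S]: \<open>L\<close> for values and hence speeds,
  \<open>M\<close> for slopes, and \<open>V\<close>, speed times slope plus source, for the rate of
  change in time.\<close>

definition L where "L = Z + S * A"
definition M where "M = P + S * B"
definition V where "V = L * M + A"

lemma LMV_nonneg: "L \<ge> 0" "M \<ge> 0" "V \<ge> 0"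
  using const_nonneg S_pos by (auto simp: L_def M_def V_def)

text \<open>Nonpositive values make the speeds nonpositive, so the foot lies to the right of x and
  the half-line is never left; a step then only adds d F, which lies between -d A and 0.\<close>

lemma zs_bounds_aux:
  assumes "d > 0" "x \<ge> 0"
  shows "- Z - real k * d * A \<le> zs d k i x \<and> zs d k i x \<le> 0"
  using assms(2)
proof (induction k arbitrary: i x)
  case 0 then show ?case using z0_bounds by auto
next
  case (Suc k)
  have "wave_speed (\<lambda>j. zs d k j x) i \<le> 0"
    using Suc by (intro wave_speed_le) auto
  then have "foot d k i x \<ge> x" using assms(1) by (auto simp: foot_def mult_le_0_iff)
  then have "foot d k i x \<ge> 0" using Suc by simp
  from Suc.IH[OF this, of i] have 1: "- Z - real k * d * A \<le> zs d k i (foot d k i x)"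
    "zs d k i (foot d k i x) \<le> 0" by auto
  have "d * F x \<le> 0" "- (d * A) \<le> d * F x"
    using F_bounds[OF Suc.prems] assms(1) mult_left_mono[of "-A" "F x" d] by (auto simp: mult_le_0_iff)
  with 1 show ?case unfolding zs_Suc by (auto simp: algebra_simps)
qed

lemma zs_bounds:
  assumes "d > 0" "real k * d \<le> S" "x \<ge> 0"
  shows "- L \<le> zs d k i x" "zs d k i x \<le> 0"
proof -
  have "real k * d * A \<le> S * A" using assms const_nonneg by (intro mult_right_mono) auto
  then show "- L \<le> zs d k i x" "zs d k i x \<le> 0"
    using zs_bounds_aux[OF assms(1,3), of k i] by (auto simp: L_def)
qed

lemma foot_bounds:
  assumes "d > 0" "real k * d \<le> S" "x \<ge> 0"
  shows "x \<le> foot d k i x" "foot d k i x \<le> x + d * L"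
proof -
  have "wave_speed (\<lambda>j. zs d k j x) i \<le> 0" "- L \<le> wave_speed (\<lambda>j. zs d k j x) i"
    using zs_bounds[OF assms] by (auto intro!: wave_speed_le wave_speed_ge)
  then show "x \<le> foot d k i x" "foot d k i x \<le> x + d * L"
    using assms(1) mult_left_mono[of "-L" "wave_speed (\<lambda>j. zs d k j x) i" d] 
    by (auto simp: foot_def mult_le_0_iff)
qed

lemma foot_nonneg:
  assumes "d > 0" "real k * d \<le> S" "x \<ge> 0"
  shows "foot d k i x \<ge> 0"
  using foot_bounds[OF assms, of i] assms by linarith

text \<open>A joint induction, because the bounds at stage k put the factor 1 - d w of the chain
  rule into [0, 1]: the slope carried over from the foot keeps its sign and does not grow, and the
  source adds at most d B.\<close>

lemma ps_props:
  assumes "d > 0" "d * M \<le> 1" "real k * d \<le> S" "x \<ge> 0"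
  shows "(zs d k i has_real_derivative ps d k i x) (at x within {0..}) \<and>
    0 \<le> ps d k i x \<and> ps d k i x \<le> P + real k * d * B"
  using assms(3,4)
proof (induction k arbitrary: i x)
  case 0 then show ?case using z0_deriv p0_bounds by auto
next
  case (Suc k)
  have kS: "real k * d \<le> S" using Suc.prems assms(1) by (simp add: algebra_simps)
  have kB: "P + real k * d * B \<le> M"
    using mult_right_mono[OF kS, of B] const_nonneg by (auto simp: M_def)
  have fx: "foot d k i x \<ge> 0" using foot_nonneg[OF assms(1) kS] Suc.prems by auto
  have IHf: "(zs d k i has_real_derivative ps d k i (foot d k i x)) (at (foot d k i x) within {0..})"
    "0 \<le> ps d k i (foot d k i x)" "ps d k i (foot d k i x) \<le> P + real k * d * B"
    using Suc.IH[OF kS fx] by auto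
  have "((\<lambda>x. wave_speed (\<lambda>j. zs d k j x) i) has_real_derivative wave_speed (\<lambda>j. ps d k j x) i)
      (at x within {0..})"
    using Suc.IH[OF kS Suc.prems(2)] by (intro wave_speed_has_real_derivative) auto
  then have df: "(foot d k i has_real_derivative 1 - d * wave_speed (\<lambda>j. ps d k j x) i) (at x within {0..})"
    unfolding foot_def by (auto intro!: derivative_eq_intros)
  \<comment> \<open>\<open>DERIV_image_chain\<close> wants the derivative within the image of the
    half-line under \<open>foot\<close>, which is a subset of the half-line.\<close>
  have "(zs d k i has_real_derivative ps d k i (foot d k i x)) (at (foot d k i x) within foot d k i ` {0..})"
    using IHf(1) by (rule has_field_derivative_subset) (auto intro: foot_nonneg[OF assms(1) kS])
  from DERIV_image_chain[OF this df]
  have "((\<lambda>x. zs d k i (foot d k i x) + d * F x) has_real_derivative ps d (Suc k) i x) (at x within {0..})"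
    using F_deriv[OF Suc.prems(2)] by (auto intro!: derivative_eq_intros simp: o_def)
  moreover have "zs d (Suc k) i = (\<lambda>x. zs d k i (foot d k i x) + d * F x)"
    by (simp add: foot_def fun_eq_iff)
  ultimately have 1: "(zs d (Suc k) i has_real_derivative ps d (Suc k) i x) (at x within {0..})"
    by simp
  have w: "0 \<le> wave_speed (\<lambda>j. ps d k j x) i" "wave_speed (\<lambda>j. ps d k j x) i \<le> M"
    using Suc.IH[OF kS Suc.prems(2)] kB by (auto intro!: wave_speed_le wave_speed_ge intro: order_trans)
  let ?w = "1 - d * wave_speed (\<lambda>j. ps d k j x) i"
  have "d * wave_speed (\<lambda>j. ps d k j x) i \<le> d * M"
    using w assms by (intro mult_left_mono) auto
  also note assms(2)
  finally have w': "0 \<le> ?w" "?w \<le> 1" using w assms(1) by auto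
  have "0 \<le> ps d k i (foot d k i x) * ?w" using w' IHf by auto
  moreover have "ps d k i (foot d k i x) * ?w \<le> ps d k i (foot d k i x)"
    using w' IHf by (simp add: mult_left_le)
  moreover have "0 \<le> d * F' x" "d * F' x \<le> d * B"
    using F'_bounds[OF Suc.prems(2)] assms by auto
  ultimately show ?case using 1 IHf by (auto simp: algebra_simps)
qed

lemma zs_deriv:
  assumes "d > 0" "d * M \<le> 1" "real k * d \<le> S" "x \<ge> 0"
  shows "(zs d k i has_real_derivative ps d k i x) (at x within {0..})"
  using ps_props[OF assms] by auto

lemma ps_bounds:
  assumes "d > 0" "d * M \<le> 1" "real k * d \<le> S" "x \<ge> 0"
  shows "0 \<le> ps d k i x" "ps d k i x \<le> M"
proof -
  have "real k * d * B \<le> S * B" using assms const_nonneg by (intro mult_right_mono) auto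
  then show "0 \<le> ps d k i x" "ps d k i x \<le> M"
    using ps_props[OF assms, of i] by (auto simp: M_def)
qed

lemma zs_mono_Lipschitz:
  assumes "d > 0" "d * M \<le> 1" "real k * d \<le> S" "0 \<le> x" "x \<le> y"
  shows "0 \<le> zs d k i y - zs d k i x" "zs d k i y - zs d k i x \<le> M * (y - x)"
proof -
  obtain \<xi> where \<xi>: "min x y \<le> \<xi>" "zs d k i y - zs d k i x = ps d k i \<xi> * (y - x)"
    using half_line_mvt[OF zs_deriv[OF assms(1-3)], of x y] assms(4,5) by (metis order_trans)
  then have "0 \<le> ps d k i \<xi>" "ps d k i \<xi> \<le> M" using ps_bounds[OF assms(1-3), of \<xi>] assms by auto
  then show "0 \<le> zs d k i y - zs d k i x" "zs d k i y - zs d k i x \<le> M * (y - x)"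
    using \<xi> assms by (auto intro: mult_right_mono)
qed

lemma zs_Lipschitz:
  assumes "d > 0" "d * M \<le> 1" "real k * d \<le> S" "0 \<le> x" "0 \<le> y"
  shows "\<bar>zs d k i y - zs d k i x\<bar> \<le> M * \<bar>y - x\<bar>"
  using zs_mono_Lipschitz[OF assms(1-3), of x y i] zs_mono_Lipschitz[OF assms(1-3), of y x i] assms(4,5)
  by (cases "x \<le> y") auto

lemma foot_contraction:
  assumes "d > 0" "d * M \<le> 1" "real k * d \<le> S" "0 \<le> x" "0 \<le> y"
  shows "\<bar>foot d k i y - foot d k i x\<bar> \<le> \<bar>y - x\<bar>"
proof -
  have *: "0 \<le> foot d k i b - foot d k i a \<and> foot d k i b - foot d k i a \<le> b - a" if "0 \<le> a" "a \<le> b" for a b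
  proof -
    let ?w = "wave_speed (\<lambda>j. zs d k j b - zs d k j a) i"
    have "0 \<le> ?w" "?w \<le> M * (b - a)"
      using zs_mono_Lipschitz[OF assms(1-3) that] by (auto intro!: wave_speed_le wave_speed_ge)
    then have "0 \<le> d * ?w" "d * ?w \<le> (d * M) * (b - a)"
      using assms(1) by (auto simp: mult.assoc)
    moreover have "(d * M) * (b - a) \<le> 1 * (b - a)" using assms that by (intro mult_right_mono) auto
    moreover have "foot d k i b - foot d k i a = (b - a) - d * ?w"
      by (simp add: foot_def wave_speed_def field_simps)
    ultimately show ?thesis by auto
  qed
  show ?thesis using *[of x y] *[of y x] assms(4,5) by (cases "x \<le> y") auto
qed

section \<open>Equicontinuity of the slopes, by a discrete Gronwall argument\<close>

lemma power_exp_bound: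
  assumes "c \<ge> 0" "d > 0" "real k * d \<le> S"
  shows "(1 + c * d) ^ k \<le> exp (c * S)"
proof -
  have "(1 + c * d) ^ k \<le> exp (c * d) ^ k"
    using assms by (intro power_mono) (auto simp: exp_ge_add_one_self)
  also have "\<dots> = exp (c * (real k * d))" by (simp add: exp_of_nat_mult[symmetric] ac_simps)
  also have "\<dots> \<le> exp (c * S)" using assms by (auto intro: mult_left_mono)
  finally show ?thesis .
qed

text \<open>A foot lies at most d L to the right, so the admissible range of x shrinks by that much
  per step, and nonexpansiveness of \<open>foot\<close> preserves the distance \<delta>. In the
  growth factor, M d comes from the varying slope of the speed and d from the source.\<close>

lemma ps_modulus_step:
  assumes "d > 0" "d * M \<le> 1" "e > 0"
    and base: "\<And>i x y. 0 \<le> x \<Longrightarrow> x \<le> R \<Longrightarrow> 0 \<le> y \<Longrightarrow> y \<le> R \<Longrightarrow> \<bar>x - y\<bar> \<le> \<delta> \<Longrightarrow>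
        \<bar>p0 i x - p0 i y\<bar> \<le> e \<and> \<bar>F' x - F' y\<bar> \<le> e"
    and "real k * d \<le> S" "0 \<le> x" "0 \<le> y" "x \<le> R - real k * d * L" "y \<le> R - real k * d * L" "\<bar>x - y\<bar> \<le> \<delta>"
  shows "\<bar>ps d k i x - ps d k i y\<bar> \<le> e * (1 + (M + 1) * d) ^ k"
  using assms(5-)
proof (induction k arbitrary: i x y)
  case 0 then show ?case using base by auto
next
  case (Suc k)
  have kS: "real k * d \<le> S" using Suc.prems assms(1) by (simp add: algebra_simps)
  have kS': "real k * d + d \<le> S" using Suc.prems by (simp add: algebra_simps)
  let ?w = "e * (1 + (M + 1) * d) ^ k"
  have pw: "1 \<le> (1 + (M + 1) * d) ^ k"
    using LMV_nonneg assms(1) by (intro one_le_power) auto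
  have ew: "e \<le> ?w" using mult_left_mono[OF pw, of e] assms(3) by auto
  have Ld: "L * d \<ge> 0" "real k * d * L \<ge> 0" using LMV_nonneg assms(1) by auto
  let ?fx = "foot d k i x" and ?fy = "foot d k i y"
  have f: "0 \<le> ?fx" "0 \<le> ?fy" "?fx \<le> R - real k * d * L" "?fy \<le> R - real k * d * L"
    using foot_bounds[OF assms(1) kS, of x i] foot_bounds[OF assms(1) kS, of y i] Suc.prems
    by (auto simp: algebra_simps)
  have fd: "\<bar>?fx - ?fy\<bar> \<le> \<delta>"
    using foot_contraction[OF assms(1,2) kS, of y x i] Suc.prems by auto
  have 1: "\<bar>ps d k i ?fx - ps d k i ?fy\<bar> \<le> ?w" by (rule Suc.IH[OF kS f fd])
  let ?a = "wave_speed (\<lambda>j. ps d k j x) i" and ?b = "wave_speed (\<lambda>j. ps d k j y) i"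
  have 2: "\<bar>?a - ?b\<bar> \<le> ?w"
    using Suc.IH[OF kS Suc.prems(2,3)] Suc.prems Ld
    by (intro wave_speed_dist_le) (auto simp: algebra_simps)
  have 3: "0 \<le> ?a" "?a \<le> M" using ps_bounds[OF assms(1,2) kS Suc.prems(2)]
    by (auto intro!: wave_speed_le wave_speed_ge)
  have "d * ?a \<le> d * M" using 3 assms(1) by (intro mult_left_mono) auto
  also note assms(2)
  finally have "d * ?a \<le> 1" .
  moreover have "0 \<le> d * ?a" using 3 assms(1) by auto
  ultimately have 4: "\<bar>1 - d * ?a\<bar> \<le> 1" by linarith
  have 5: "\<bar>ps d k i ?fy\<bar> \<le> M" using ps_bounds[OF assms(1,2) kS f(2)] by auto
  have 6: "\<bar>F' x - F' y\<bar> \<le> ?w"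
  proof -
    have "real (Suc k) * d * L \<ge> 0" using LMV_nonneg assms(1) by auto
    then have "x \<le> R" "y \<le> R" using Suc.prems by linarith+
    then have "\<bar>F' x - F' y\<bar> \<le> e" using base[of x y] Suc.prems by blast
    then show ?thesis using ew by linarith
  qed
  have "ps d (Suc k) i x - ps d (Suc k) i y =
    (ps d k i ?fx - ps d k i ?fy) * (1 - d * ?a) + ps d k i ?fy * (d * (?b - ?a)) + d * (F' x - F' y)"
    by (simp add: algebra_simps)
  also have "\<bar>\<dots>\<bar> \<le> ?w * 1 + M * (d * ?w) + d * ?w"
  proof (rule abs_triangle3_le)
    have "0 \<le> ?w" using ew assms(3) by linarith
    then show "\<bar>(ps d k i ?fx - ps d k i ?fy) * (1 - d * ?a)\<bar> \<le> ?w * 1"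
      unfolding abs_mult by (intro mult_mono 1 4) auto
    have d: "\<bar>d\<bar> = d" using assms(1) by simp
    have "d * \<bar>?b - ?a\<bar> \<le> d * ?w"
      using 2 assms(1) by (intro mult_left_mono) (simp_all add: abs_minus_commute)
    then show "\<bar>ps d k i ?fy * (d * (?b - ?a))\<bar> \<le> M * (d * ?w)"
      using LMV_nonneg assms(1) unfolding abs_mult d by (intro mult_mono 5) simp_all
    show "\<bar>d * (F' x - F' y)\<bar> \<le> d * ?w"
      using 6 assms(1) unfolding abs_mult d by (intro mult_left_mono) simp_all
  qed
  also have "\<dots> = e * (1 + (M + 1) * d) ^ Suc k" by (simp add: algebra_simps)
  finally show ?case .
qed

text \<open>One \<delta> serves all steps and stages: up to time S the data are consulted only on
  the compact interval [0, R + S L], and dividing e by exp((M + 1) S) in advance pays for the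
  accumulated growth.\<close>

lemma ps_modulus:
  assumes "e > 0"
  obtains \<delta> where "\<delta> > 0" "\<And>d k i x y. \<lbrakk>d > 0; d * M \<le> 1; real k * d \<le> S;
     0 \<le> x; x \<le> R; 0 \<le> y; y \<le> R; \<bar>x - y\<bar> \<le> \<delta>\<rbrakk> \<Longrightarrow> \<bar>ps d k i x - ps d k i y\<bar> \<le> e"
proof -
  define E where "E = exp ((M + 1) * S)"
  have E: "E > 0" by (simp add: E_def)
  define R' where "R' = R + S * L"
  have uc: "\<exists>\<delta>>0. \<forall>x y. 0 \<le> x \<and> x \<le> R' \<and> 0 \<le> y \<and> y \<le> R' \<and> \<bar>x - y\<bar> < \<delta> \<longrightarrow> \<bar>f x - f y\<bar> \<le> e / E"
    if "continuous_on {0..} f" for f :: "real \<Rightarrow> real"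
  proof -
    have "continuous_on {0..R'} f" using that by (rule continuous_on_subset) auto
    then have "uniformly_continuous_on {0..R'} f" by (intro compact_uniformly_continuous) auto
    moreover have "e / E > 0" using assms E by simp
    ultimately obtain \<delta> where "\<delta> > 0"
      "\<forall>x\<in>{0..R'}. \<forall>y\<in>{0..R'}. dist y x < \<delta> \<longrightarrow> dist (f y) (f x) < e / E"
      unfolding uniformly_continuous_on_def by blast
    then show ?thesis
      by (intro exI[of _ \<delta>]) (auto simp: dist_real_def less_imp_le abs_minus_commute)
  qed
  obtain d1 where d1: "d1 > 0" "\<And>x y. 0 \<le> x \<and> x \<le> R' \<and> 0 \<le> y \<and> y \<le> R' \<and> \<bar>x - y\<bar> < d1 \<Longrightarrow> \<bar>p0 True x - p0 True y\<bar> \<le> e / E"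
    using uc[OF p0_cont] by metis
  obtain d2 where d2: "d2 > 0" "\<And>x y. 0 \<le> x \<and> x \<le> R' \<and> 0 \<le> y \<and> y \<le> R' \<and> \<bar>x - y\<bar> < d2 \<Longrightarrow> \<bar>p0 False x - p0 False y\<bar> \<le> e / E"
    using uc[OF p0_cont] by metis
  obtain d3 where d3: "d3 > 0" "\<And>x y. 0 \<le> x \<and> x \<le> R' \<and> 0 \<le> y \<and> y \<le> R' \<and> \<bar>x - y\<bar> < d3 \<Longrightarrow> \<bar>F' x - F' y\<bar> \<le> e / E"
    using uc[OF F'_cont] by metis
  \<comment> \<open>Halving passes from the strict inequalities of uniform continuity to the weak
    one required.\<close>
  define \<delta> where "\<delta> = min d1 (min d2 d3) / 2"
  have \<delta>: "\<delta> > 0" "\<delta> < d1" "\<delta> < d2" "\<delta> < d3" using d1(1) d2(1) d3(1) by (auto simp: \<delta>_def min_def)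
  have base: "\<bar>p0 i x - p0 i y\<bar> \<le> e / E \<and> \<bar>F' x - F' y\<bar> \<le> e / E"
    if "0 \<le> x" "x \<le> R'" "0 \<le> y" "y \<le> R'" "\<bar>x - y\<bar> \<le> \<delta>" for i x y
    using d1(2)[of x y] d2(2)[of x y] d3(2)[of x y] that \<delta> by (cases i) auto
  show thesis
  proof (rule that[OF \<delta>(1)])
    fix d k i x y assume *: "d > 0" "d * M \<le> 1" "real k * d \<le> S" "0 \<le> x" "x \<le> R" "0 \<le> y" "y \<le> R" "\<bar>x - y\<bar> \<le> \<delta>"
    have "real k * d * L \<le> S * L" using * LMV_nonneg by (intro mult_right_mono) auto
    then have "x \<le> R' - real k * d * L" "y \<le> R' - real k * d * L" using * by (auto simp: R'_def)
    then have "\<bar>ps d k i x - ps d k i y\<bar> \<le> e / E * (1 + (M + 1) * d) ^ k"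
      using assms E base * by (intro ps_modulus_step[where R = R' and \<delta> = \<delta>]) auto
    also have "\<dots> \<le> e / E * E"
      unfolding E_def using assms power_exp_bound[of "M + 1" d k] * LMV_nonneg
      by (intro mult_left_mono) auto
    finally show "\<bar>ps d k i x - ps d k i y\<bar> \<le> e" using E by simp
  qed
qed

text \<open>The error is independent of the step and the stage, so this estimate survives the later
  passages to the limit.\<close>

lemma zs_Taylor:
  assumes "e > 0"
  obtains \<delta> where "\<delta> > 0" "\<And>d k i x y. \<lbrakk>d > 0; d * M \<le> 1; real k * d \<le> S;
     0 \<le> x; x \<le> R; 0 \<le> y; y \<le> R; \<bar>x - y\<bar> \<le> \<delta>\<rbrakk> \<Longrightarrow>
     \<bar>zs d k i y - zs d k i x - ps d k i x * (y - x)\<bar> \<le> e * \<bar>y - x\<bar>"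
proof -
  obtain \<delta> where \<delta>: "\<delta> > 0" "\<And>d k i x y. \<lbrakk>d > 0; d * M \<le> 1; real k * d \<le> S;
     0 \<le> x; x \<le> R; 0 \<le> y; y \<le> R; \<bar>x - y\<bar> \<le> \<delta>\<rbrakk> \<Longrightarrow> \<bar>ps d k i x - ps d k i y\<bar> \<le> e"
    using ps_modulus[OF assms, where R = R] by blast
  show thesis
  proof (rule that[OF \<delta>(1)])
    fix d k i x y assume *: "d > 0" "d * M \<le> 1" "real k * d \<le> S" "0 \<le> x" "x \<le> R" "0 \<le> y" "y \<le> R" "\<bar>x - y\<bar> \<le> \<delta>"
    obtain \<xi> where \<xi>: "min x y \<le> \<xi>" "\<xi> \<le> max x y" "zs d k i y - zs d k i x = ps d k i \<xi> * (y - x)"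
      using half_line_mvt[OF zs_deriv[OF *(1-3)], of x y] *(4,6) by metis
    have "\<bar>ps d k i \<xi> - ps d k i x\<bar> \<le> e"
      using \<xi> * by (intro \<delta>(2)[OF *(1-3)]) (auto simp: min_def max_def abs_if split: if_splits)
    then have "\<bar>ps d k i \<xi> - ps d k i x\<bar> * \<bar>y - x\<bar> \<le> e * \<bar>y - x\<bar>" by (intro mult_right_mono) auto
    then show "\<bar>zs d k i y - zs d k i x - ps d k i x * (y - x)\<bar> \<le> e * \<bar>y - x\<bar>"
      unfolding \<xi>(3) by (simp add: abs_mult[symmetric] algebra_simps)
  qed
qed

lemma zs_step_dist:
  assumes "d > 0" "d * M \<le> 1" "real k * d \<le> S" "x \<ge> 0"
  shows "\<bar>zs d (Suc k) i x - zs d k i x\<bar> \<le> d * V"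
proof -
  have f: "x \<le> foot d k i x" "foot d k i x \<le> x + d * L" using foot_bounds[OF assms(1,3,4)] by auto
  have "\<bar>zs d k i (foot d k i x) - zs d k i x\<bar> \<le> M * \<bar>foot d k i x - x\<bar>"
    using f assms by (intro zs_Lipschitz) auto
  also have "\<dots> \<le> M * (d * L)" using f LMV_nonneg by (intro mult_left_mono) auto
  finally have 1: "\<bar>zs d k i (foot d k i x) - zs d k i x\<bar> \<le> M * (d * L)" .
  have "\<bar>F x\<bar> \<le> A" using F_bounds[OF assms(4)] by auto
  then have "\<bar>d * F x\<bar> \<le> d * A" using assms(1) by (simp add: abs_mult)
  with 1 show ?thesis unfolding zs_Suc V_def by (simp add: algebra_simps)
qed

lemma zs_time_dist:
  assumes "d > 0" "d * M \<le> 1" "real l * d \<le> S" "k \<le> l" "x \<ge> 0"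
  shows "\<bar>zs d l i x - zs d k i x\<bar> \<le> real (l - k) * d * V"
  using assms(4,3)
proof (induction l rule: dec_induct)
  case base then show ?case by simp
next
  case (step l)
  have lS: "real l * d \<le> S" using step.prems assms(1) by (simp add: algebra_simps)
  show ?case
    using step.IH[OF lS] zs_step_dist[OF assms(1,2) lS assms(5), of i] step.hyps
    by (simp add: Suc_diff_le algebra_simps)
qed

section \<open>Error under halving of the step\<close>

lemma F_Lipschitz:
  assumes "0 \<le> x" "0 \<le> y"
  shows "\<bar>F y - F x\<bar> \<le> B * \<bar>y - x\<bar>"
proof -
  obtain \<xi> where "min x y \<le> \<xi>" "F y - F x = F' \<xi> * (y - x)"
    using half_line_mvt[OF F_deriv assms] by metis
  then show ?thesis using F'_bounds[of \<xi>] assms by (auto simp: abs_mult intro!: mult_right_mono)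
qed

text \<open>Local error constant. Over a half step the speeds drift by at most (d/2) V and (d/2) M L
  and the source by (d/2) B L; each is multiplied by a further d/2, whence the division by 4, and a
  shift of the foot costs a factor M.\<close>

definition Q where "Q = (M * (V + M * L) + B * L) / 4"

lemma Q_nonneg: "Q \<ge> 0" using LMV_nonneg const_nonneg by (simp add: Q_def)

text \<open>One step of size \<open>d\<close> and two steps of size \<open>d/2\<close> differ by \<open>O(d\<^sup>2)\<close> although the states are merely
  Lipschitz, because both only displace the evaluation point by slightly different amounts.\<close>

lemma zs_refine_step:
  assumes d: "d > 0" "d * M \<le> 1" and k: "real (Suc k) * d \<le> S" and "x \<ge> 0"
    and E: "\<And>j y. y \<ge> 0 \<Longrightarrow> \<bar>zs (d/2) (2 * k) j y - zs d k j y\<bar> \<le> E"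
  shows "\<bar>zs (d/2) (2 * Suc k) i x - zs d (Suc k) i x\<bar> \<le> (1 + M * d) * E + Q * d\<^sup>2"
proof -
  have h: "d/2 > 0" "d/2 * M \<le> 1" using d LMV_nonneg by auto
  have k1: "real (2 * k) * (d/2) \<le> S" "real (Suc (2 * k)) * (d/2) \<le> S" "real k * d \<le> S"
    using k d by (auto simp: algebra_simps)
  define x1 where "x1 = foot (d/2) (Suc (2*k)) i x"
  define x2 where "x2 = foot (d/2) (2*k) i x1"
  define f where "f = foot d k i x"
  have x1: "x \<le> x1" "x1 \<le> x + d/2 * L" using foot_bounds[OF h(1) k1(2) assms(4)] by (auto simp: x1_def)
  then have x1': "x1 \<ge> 0" using assms(4) by simp
  have x2: "x2 \<ge> 0" unfolding x2_def using foot_nonneg[OF h(1) k1(1) x1'] .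
  have f: "f \<ge> 0" unfolding f_def using foot_nonneg[OF d(1) k1(3) assms(4)] .
  have 1: "\<bar>zs (d/2) (Suc (2*k)) j x - zs d k j x\<bar> \<le> d/2 * V + E" for j
    using zs_step_dist[OF h k1(1) assms(4), of j] E[OF assms(4), of j] by linarith
  have 2: "\<bar>zs (d/2) (2*k) j x1 - zs d k j x\<bar> \<le> M * (d/2 * L) + E" for j
  proof -
    have "\<bar>zs (d/2) (2*k) j x1 - zs (d/2) (2*k) j x\<bar> \<le> M * \<bar>x1 - x\<bar>"
      by (rule zs_Lipschitz[OF h k1(1) assms(4) x1'])
    also have "\<dots> \<le> M * (d/2 * L)" using x1 LMV_nonneg by (intro mult_left_mono) auto
    finally show ?thesis using E[OF assms(4), of j] by linarith
  qed
  let ?w1 = "wave_speed (\<lambda>j. zs (d/2) (Suc (2*k)) j x) i"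
  let ?w2 = "wave_speed (\<lambda>j. zs (d/2) (2*k) j x1) i"
  let ?w = "wave_speed (\<lambda>j. zs d k j x) i"
  have w: "\<bar>?w1 - ?w\<bar> \<le> d/2 * V + E" "\<bar>?w2 - ?w\<bar> \<le> M * (d/2 * L) + E"
    by (rule wave_speed_dist_le, rule 1, rule wave_speed_dist_le, rule 2)
  have "x2 - f = - (d/2 * ((?w1 - ?w) + (?w2 - ?w)))"
    by (simp add: x2_def x1_def f_def foot_def field_simps del: zs.simps)
  then have "\<bar>x2 - f\<bar> = d/2 * \<bar>(?w1 - ?w) + (?w2 - ?w)\<bar>" using d by (simp add: abs_mult)
  also have "\<dots> \<le> d/2 * (d/2 * V + E + (M * (d/2 * L) + E))"
    using w d by (intro mult_left_mono) linarith+
  finally have "\<bar>x2 - f\<bar> \<le> d * E + d\<^sup>2 * (V + M * L) / 4"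
    by (simp add: field_simps power2_eq_square)
  then have 3: "M * \<bar>x2 - f\<bar> \<le> M * (d * E + d\<^sup>2 * (V + M * L) / 4)"
    using LMV_nonneg by (intro mult_left_mono)
  have 4: "\<bar>zs d k i x2 - zs d k i f\<bar> \<le> M * \<bar>x2 - f\<bar>"
    by (rule zs_Lipschitz[OF d k1(3) f x2])
  have "\<bar>F x1 - F x\<bar> \<le> B * \<bar>x1 - x\<bar>" by (rule F_Lipschitz[OF assms(4) x1'])
  also have "\<dots> \<le> B * (d/2 * L)" using x1 const_nonneg by (intro mult_left_mono) auto
  finally have "d/2 * \<bar>F x1 - F x\<bar> \<le> d/2 * (B * (d/2 * L))" using d by (intro mult_left_mono) auto
  moreover have "\<bar>d/2 * (F x1 - F x)\<bar> = d/2 * \<bar>F x1 - F x\<bar>" using d by (simp only: abs_mult)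
  ultimately have 5: "\<bar>d/2 * (F x1 - F x)\<bar> \<le> d\<^sup>2 * (B * L) / 4"
    by (simp only: power2_eq_square) (simp add: field_simps)
  have "zs (d/2) (2 * Suc k) i x = zs (d/2) (2*k) i x2 + d/2 * F x1 + d/2 * F x"
    by (simp only: mult_Suc_right add_2_eq_Suc zs_Suc x1_def[symmetric] x2_def[symmetric])
  moreover have "zs d (Suc k) i x = zs d k i f + d * F x" by (simp only: zs_Suc f_def)
  \<comment> \<open>The inherited error, the displaced foot and the displaced evaluation of
    F.\<close>
  ultimately have "zs (d/2) (2 * Suc k) i x - zs d (Suc k) i x =
     (zs (d/2) (2*k) i x2 - zs d k i x2) + (zs d k i x2 - zs d k i f) + d/2 * (F x1 - F x)"
    by (simp add: field_simps del: zs.simps mult_Suc_right)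
  then have "\<bar>zs (d/2) (2 * Suc k) i x - zs d (Suc k) i x\<bar> \<le> 
      E + M * (d * E + d\<^sup>2 * (V + M * L) / 4) + d\<^sup>2 * (B * L) / 4"
    using E[OF x2, of i] 3 4 5 by linarith
  also have "\<dots> = (1 + M * d) * E + Q * d\<^sup>2" by (simp add: Q_def algebra_simps add_divide_distrib)
  finally show ?thesis .
qed

definition K where "K = Q * S * exp (M * S)"

text \<open>Local errors Q d^2 add up over k steps, amplified by at most exp(M S); since k d is at
  most S, one power of d remains.\<close>

lemma zs_refine:
  assumes "d > 0" "d * M \<le> 1" "real k * d \<le> S" "x \<ge> 0"
  shows "\<bar>zs (d/2) (2 * k) i x - zs d k i x\<bar> \<le> K * d"
proof -
  have "\<bar>zs (d/2) (2 * k) i x - zs d k i x\<bar> \<le> Q * d\<^sup>2 * real k * (1 + M * d) ^ k"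
    using assms(3,4)
  proof (induction k arbitrary: i x)
    case 0 then show ?case by simp
  next
    case (Suc k)
    have kS: "real k * d \<le> S" using Suc.prems assms(1) by (simp add: algebra_simps)
    have "\<bar>zs (d/2) (2 * Suc k) i x - zs d (Suc k) i x\<bar> \<le>
        (1 + M * d) * (Q * d\<^sup>2 * real k * (1 + M * d) ^ k) + Q * d\<^sup>2 * 1"
      using zs_refine_step[OF assms(1,2) Suc.prems Suc.IH[OF kS]] by simp
    also have "\<dots> \<le> (1 + M * d) * (Q * d\<^sup>2 * real k * (1 + M * d) ^ k) + Q * d\<^sup>2 * (1 + M * d) ^ Suc k"
      using assms LMV_nonneg Q_nonneg by (intro add_left_mono mult_left_mono one_le_power) auto
    also have "\<dots> = Q * d\<^sup>2 * real (Suc k) * (1 + M * d) ^ Suc k" by (simp add: algebra_simps)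
    finally show ?case .
  qed
  also have "\<dots> \<le> Q * d\<^sup>2 * real k * exp (M * S)"
    using assms LMV_nonneg Q_nonneg power_exp_bound[of M d k] by (intro mult_left_mono) auto
  also have "\<dots> = (Q * exp (M * S) * d) * (real k * d)" by (simp add: power2_eq_square algebra_simps)
  also have "\<dots> \<le> (Q * exp (M * S) * d) * S"
    using assms Q_nonneg by (intro mult_left_mono) auto
  finally show ?thesis by (simp add: K_def algebra_simps)
qed

end

section \<open>Limit of the approximations along dyadic steps\<close>

lemma geometric_Cauchy:
  fixes a :: "nat \<Rightarrow> real"
  assumes "\<And>n. \<bar>a (Suc n) - a n\<bar> \<le> c / 2 ^ n"
  shows "convergent a" "\<bar>lim a - a n\<bar> \<le> 2 * c / 2 ^ n"
proof -
  \<comment> \<open>Subtracting the tail at m makes the induction telescope exactly.\<close>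
  have *: "\<bar>a m - a n\<bar> \<le> 2 * c / 2 ^ n - 2 * c / 2 ^ m" if "n \<le> m" for n m
    using that
  proof (induction m rule: dec_induct)
    case base then show ?case by simp
  next
    case (step m)
    have "2 * c / 2 ^ Suc m = 2 * c / 2 ^ m - c / 2 ^ m" by (simp add: field_simps)
    then show ?case using step.IH assms[of m] by linarith
  qed
  have c: "c \<ge> 0" using order_trans[OF abs_ge_zero assms[of 0]] by simp
  have **: "\<bar>a m - a n\<bar> \<le> 2 * c / 2 ^ n" if "n \<le> m" for n m
  proof -
    have "2 * c / 2 ^ m \<ge> 0" using c by simp
    then show ?thesis using *[OF that] by linarith
  qed
  have lim0: "(\<lambda>n. 2 * c / 2 ^ n) \<longlonglongrightarrow> 0" by (rule LIMSEQ_divide_realpow_zero) simp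
  have "Cauchy a"
  proof (rule metric_CauchyI)
    fix e :: real assume "e > 0"
    then have "\<forall>\<^sub>F n in sequentially. 2 * c / 2 ^ n < e / 2" 
      using order_tendstoD(2)[OF lim0, of "e/2"] by auto
    then obtain N where "2 * c / 2 ^ N < e / 2" by (meson eventually_sequentially order_refl)
    then have "dist (a m) (a N) < e / 2" if "m \<ge> N" for m
      using **[OF that] by (simp add: dist_real_def)
    then show "\<exists>N. \<forall>m\<ge>N. \<forall>n\<ge>N. dist (a m) (a n) < e"
      by (meson dist_triangle_half_l dist_commute)
  qed
  then show "convergent a" by (rule Cauchy_convergent)
  then have "(\<lambda>m. \<bar>a m - a n\<bar>) \<longlonglongrightarrow> \<bar>lim a - a n\<bar>"
    by (intro tendsto_intros) (simp add: convergent_LIMSEQ_iff)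
  then show "\<bar>lim a - a n\<bar> \<le> 2 * c / 2 ^ n"
    by (rule LIMSEQ_le_const2) (use ** in blast)
qed

context diagonal_system
begin

text \<open>Starting from 1 / (M + 1) ensures d M <= 1 at every level; halving is what
  \<open>zs_refine\<close> compares.\<close>

definition ds :: "nat \<Rightarrow> real" where "ds n = 1 / (M + 1) / 2 ^ n"

lemma ds_pos: "ds n > 0"
  using LMV_nonneg by (simp add: ds_def)

lemma ds_M: "ds n * M \<le> 1"
proof -
  have "M * 1 \<le> (M + 1) * 2 ^ n" using LMV_nonneg by (intro mult_mono) auto
  moreover have "ds n * M = M / ((M + 1) * 2 ^ n)" by (simp add: ds_def)
  moreover have "(M + 1) * 2 ^ n > 0" using LMV_nonneg by simp
  ultimately show ?thesis by (simp only: divide_le_eq_1_pos mult_1_right)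
qed

lemma ds_Suc: "ds (Suc n) = ds n / 2"
  by (simp add: ds_def)

lemma ds_lim: "ds \<longlonglongrightarrow> 0"
  unfolding ds_def by (rule LIMSEQ_divide_realpow_zero) simp

lemma eventually_ds_le: "c > 0 \<Longrightarrow> \<forall>\<^sub>F n in sequentially. C * ds n \<le> c"
  using order_tendstoD(2)[OF tendsto_mult_right_zero[OF ds_lim, of C], of c]
  by (auto elim: eventually_mono)

text \<open>Number of whole steps completed by time t; the approximations are thus piecewise
  constant in time.\<close>

definition idx :: "nat \<Rightarrow> real \<Rightarrow> nat" where "idx n t = nat \<lfloor>t / ds n\<rfloor>"

lemma idx_bounds:
  assumes "t \<ge> 0"
  shows "real (idx n t) * ds n \<le> t" "t < (real (idx n t) + 1) * ds n"
proof -
  have "real (idx n t) = of_int \<lfloor>t / ds n\<rfloor>"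
    using assms ds_pos[of n] by (simp add: idx_def)
  then have "real (idx n t) \<le> t / ds n" "t / ds n < real (idx n t) + 1"
    by linarith+
  then show "real (idx n t) * ds n \<le> t" "t < (real (idx n t) + 1) * ds n"
    using ds_pos[of n] by (auto simp: field_simps)
qed

lemma idx_grid [simp]: "idx n (real k * ds n) = k"
  using ds_pos[of n] by (simp add: idx_def)

lemma idx_mono: "t \<le> t' \<Longrightarrow> idx n t \<le> idx n t'"
  unfolding idx_def using ds_pos[of n] by (intro nat_mono floor_mono) (simp add: divide_right_mono)

text \<open>Halving cuts the step interval containing t into two, and t lies in one of the
  halves.\<close>

lemma idx_Suc: 
  assumes "t \<ge> 0"
  shows "idx (Suc n) t = 2 * idx n t \<or> idx (Suc n) t = Suc (2 * idx n t)"
proof -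
  note b = idx_bounds[OF assms, of n] idx_bounds[OF assms, of "Suc n"]
  have "real (2 * idx n t) * (ds n / 2) < (real (idx (Suc n) t) + 1) * (ds n / 2)"
    "real (idx (Suc n) t) * (ds n / 2) < real (2 * idx n t + 2) * (ds n / 2)"
    using b unfolding ds_Suc by (simp_all add: algebra_simps)
  then have "real (2 * idx n t) < real (idx (Suc n) t) + 1" "real (idx (Suc n) t) < real (2 * idx n t + 2)"
    using ds_pos[of n] by (auto simp: mult_less_cancel_right)
  then show ?thesis by linarith
qed

lemma idx_lim:
  assumes "t \<ge> 0"
  shows "(\<lambda>n. real (idx n t) * ds n) \<longlonglongrightarrow> t"
proof (rule tendsto_sandwich)
  show "\<forall>\<^sub>F n in sequentially. t - ds n \<le> real (idx n t) * ds n"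
    using idx_bounds[OF assms] by (auto intro!: always_eventually simp: algebra_simps less_imp_le)
  show "\<forall>\<^sub>F n in sequentially. real (idx n t) * ds n \<le> t" using idx_bounds[OF assms] by auto
  show "(\<lambda>n. t - ds n) \<longlonglongrightarrow> t" using tendsto_diff[OF tendsto_const ds_lim, of t] by simp
qed auto

definition zn :: "nat \<Rightarrow> real \<Rightarrow> bool \<Rightarrow> real \<Rightarrow> real" where
  "zn n t i x = zs (ds n) (idx n t) i x"

definition pn :: "nat \<Rightarrow> real \<Rightarrow> bool \<Rightarrow> real \<Rightarrow> real" where
  "pn n t i x = ps (ds n) (idx n t) i x"

lemma idx_le: "0 \<le> t \<Longrightarrow> t \<le> S \<Longrightarrow> real (idx n t) * ds n \<le> S"
  using idx_bounds(1)[of t n] by linarith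

text \<open>Besides the refinement error K d, the finer grid may already have taken one more half
  step, which costs at most V d.\<close>

lemma zn_refine:
  assumes "0 \<le> t" "t \<le> S" "x \<ge> 0"
  shows "\<bar>zn (Suc n) t i x - zn n t i x\<bar> \<le> (K + V) * ds n"
proof -
  note b = ds_pos[of n] ds_M[of n] idx_le[OF assms(1,2), of n]
  have 1: "\<bar>zs (ds n / 2) (2 * idx n t) i x - zs (ds n) (idx n t) i x\<bar> \<le> K * ds n"
    by (rule zs_refine[OF b assms(3)])
  have 2: "real (2 * idx n t) * ds (Suc n) \<le> S" using b(3) by (simp add: ds_Suc)
  have "\<bar>zs (ds (Suc n)) (idx (Suc n) t) i x - zs (ds (Suc n)) (2 * idx n t) i x\<bar> \<le> V * ds n"
    using idx_Suc[OF assms(1), of n]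
  proof
    assume "idx (Suc n) t = 2 * idx n t" then show ?thesis using LMV_nonneg b by simp
  next
    assume *: "idx (Suc n) t = Suc (2 * idx n t)"
    have "\<bar>zs (ds (Suc n)) (Suc (2 * idx n t)) i x - zs (ds (Suc n)) (2 * idx n t) i x\<bar> \<le> ds (Suc n) * V"
      by (rule zs_step_dist[OF ds_pos ds_M 2 assms(3)])
    also have "\<dots> \<le> V * ds n" using LMV_nonneg b by (simp add: ds_Suc)
    finally show ?thesis unfolding * .
  qed
  then show ?thesis using 1 unfolding zn_def ds_Suc by (simp add: algebra_simps)
qed

definition z :: "real \<Rightarrow> bool \<Rightarrow> real \<Rightarrow> real" where
  "z t i x = lim (\<lambda>n. zn n t i x)"

definition Dz where "Dz = 2 * (K + V)"

lemma zn_lim: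
  assumes "0 \<le> t" "t \<le> S" "x \<ge> 0"
  shows "(\<lambda>n. zn n t i x) \<longlonglongrightarrow> z t i x" "\<bar>z t i x - zn n t i x\<bar> \<le> Dz * ds n"
proof -
  have *: "\<bar>zn (Suc n) t i x - zn n t i x\<bar> \<le> (K + V) / (M + 1) / 2 ^ n" for n
    using zn_refine[OF assms, of n i] by (simp add: ds_def)
  show "(\<lambda>n. zn n t i x) \<longlonglongrightarrow> z t i x"
    using geometric_Cauchy(1)[OF *] unfolding z_def by (simp add: convergent_LIMSEQ_iff)
  show "\<bar>z t i x - zn n t i x\<bar> \<le> Dz * ds n"
    using geometric_Cauchy(2)[OF *, of n] unfolding z_def Dz_def by (simp add: ds_def)
qed

lemma z_0: "x \<ge> 0 \<Longrightarrow> z 0 i x = z0 i x"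
proof -
  assume "x \<ge> 0"
  have "zn n 0 i x = z0 i x" for n by (simp add: zn_def idx_def)
  then show ?thesis using zn_lim(1)[of 0 x i] S_pos \<open>x \<ge> 0\<close> by (auto intro: LIMSEQ_unique)
qed

lemma z_bounds:
  assumes "0 \<le> t" "t \<le> S" "x \<ge> 0"
  shows "- L \<le> z t i x" "z t i x \<le> 0"
proof -
  have *: "- L \<le> zn n t i x" "zn n t i x \<le> 0" for n
    using zs_bounds[OF ds_pos idx_le[OF assms(1,2)] assms(3)] by (auto simp: zn_def)
  show "- L \<le> z t i x" by (rule LIMSEQ_le_const[OF zn_lim(1)[OF assms]]) (use * in auto)
  show "z t i x \<le> 0" by (rule LIMSEQ_le_const2[OF zn_lim(1)[OF assms]]) (use * in auto)
qed

text \<open>For the approximations the elapsed time is a multiple of the step and may differ from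
  the true one; by \<open>idx_lim\<close> the discrepancy vanishes in the limit.\<close>

lemma z_Lipschitz:
  assumes "0 \<le> t" "t \<le> S" "0 \<le> t'" "t' \<le> S" "x \<ge> 0" "x' \<ge> 0"
  shows "\<bar>z t i x - z t' i x'\<bar> \<le> V * \<bar>t - t'\<bar> + M * \<bar>x - x'\<bar>"
proof -
  have time: "\<bar>z t' i x - z t i x\<bar> \<le> V * (t' - t)" if "0 \<le> t" "t \<le> t'" "t' \<le> S" for t t'
  proof -
    have "\<bar>zn n t' i x - zn n t i x\<bar> \<le> (real (idx n t') * ds n - real (idx n t) * ds n) * V" for n
      using zs_time_dist[OF ds_pos ds_M idx_le idx_mono[OF that(2), of n] assms(5), of i] that
      by (simp add: zn_def idx_mono of_nat_diff algebra_simps)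
    moreover have "(\<lambda>n. \<bar>zn n t' i x - zn n t i x\<bar>) \<longlonglongrightarrow> \<bar>z t' i x - z t i x\<bar>"
      using that assms by (intro tendsto_intros zn_lim) auto
    moreover have "(\<lambda>n. (real (idx n t') * ds n - real (idx n t) * ds n) * V) \<longlonglongrightarrow> (t' - t) * V"
      using that assms by (intro tendsto_intros idx_lim) auto
    ultimately have "\<bar>z t' i x - z t i x\<bar> \<le> (t' - t) * V" by (intro LIMSEQ_le) auto
    then show ?thesis by (simp add: mult.commute)
  qed
  have 1: "\<bar>z t i x - z t' i x\<bar> \<le> V * \<bar>t - t'\<bar>"
    using time[of t t'] time[of t' t] assms by (cases "t \<le> t'") (auto simp: abs_minus_commute)
  have "\<bar>zn n t' i x - zn n t' i x'\<bar> \<le> M * \<bar>x - x'\<bar>" for n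
    unfolding zn_def by (rule zs_Lipschitz[OF ds_pos ds_M idx_le]) (use assms in auto)
  moreover have "(\<lambda>n. \<bar>zn n t' i x - zn n t' i x'\<bar>) \<longlonglongrightarrow> \<bar>z t' i x - z t' i x'\<bar>"
    using assms by (intro tendsto_intros zn_lim) auto
  ultimately have "\<bar>z t' i x - z t' i x'\<bar> \<le> M * \<bar>x - x'\<bar>" by (intro LIMSEQ_le_const2) auto
  with 1 show ?thesis by linarith
qed

lemma pn_bounds:
  assumes "0 \<le> t" "t \<le> S" "x \<ge> 0"
  shows "0 \<le> pn n t i x" "pn n t i x \<le> M"
  using ps_bounds[OF ds_pos ds_M idx_le[OF assms(1,2)] assms(3)] by (auto simp: pn_def)

text \<open>The derivatives of a uniformly Cauchy sequence with equicontinuous derivatives are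
  locally uniformly Cauchy, since they are close to difference quotients of fixed width.\<close>

lemma pn_Cauchy:
  assumes "e > 0"
  shows "\<exists>N. \<forall>m\<ge>N. \<forall>n\<ge>N. \<forall>t x i. 0 \<le> t \<longrightarrow> t \<le> S \<longrightarrow> 0 \<le> x \<longrightarrow> x \<le> R \<longrightarrow> \<bar>pn m t i x - pn n t i x\<bar> \<le> e"
proof -
  have "e / 4 > 0" using assms by simp
  then obtain \<delta> where \<delta>: "\<delta> > 0" "\<And>d k i x y. \<lbrakk>d > 0; d * M \<le> 1; real k * d \<le> S;
     0 \<le> x; x \<le> R + 1; 0 \<le> y; y \<le> R + 1; \<bar>x - y\<bar> \<le> \<delta>\<rbrakk> \<Longrightarrow>
     \<bar>zs d k i y - zs d k i x - ps d k i x * (y - x)\<bar> \<le> e / 4 * \<bar>y - x\<bar>"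
    using zs_Taylor[of "e/4" "R + 1"] by blast
  \<comment> \<open>The fixed width, at most 1 so that x + h stays in range. Two Taylor errors e h /
    4 and four errors e h / 8 in the values add up to e h.\<close>
  define h where "h = min \<delta> 1"
  have h: "h > 0" "h \<le> \<delta>" "h \<le> 1" using \<delta> by (auto simp: h_def)
  have "e * h / 8 > 0" using assms h by simp
  then obtain N where N: "\<And>n. n \<ge> N \<Longrightarrow> Dz * ds n \<le> e * h / 8"
    using eventually_ds_le[of "e * h / 8" Dz] unfolding eventually_sequentially by blast
  have "\<bar>pn m t i x - pn n t i x\<bar> \<le> e"
    if *: "m \<ge> N" "n \<ge> N" "0 \<le> t" "t \<le> S" "0 \<le> x" "x \<le> R" for m n t x i
  proof -
    have T: "\<bar>zn k t i (x + h) - zn k t i x - pn k t i x * h\<bar> \<le> e / 4 * h" for k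
      using \<delta>(2)[OF ds_pos[of k] ds_M idx_le[OF *(3,4)], of x "x + h" i] * h by (simp add: zn_def pn_def)
    have c: "\<bar>zn k t i y - z t i y\<bar> \<le> e * h / 8" if "k \<ge> N" "y \<ge> 0" for k y
      using zn_lim(2)[OF *(3,4) that(2), of i k] N[OF that(1)] by linarith
    have "x + h \<ge> 0" using * h by simp
    then have "\<bar>pn m t i x * h - pn n t i x * h\<bar> \<le> e * h"
      using T[of m] T[of n] c[OF *(1,5)] c[OF *(2,5)] c[OF *(1), of "x + h"] c[OF *(2), of "x + h"] by linarith
    then have "\<bar>pn m t i x - pn n t i x\<bar> * h \<le> e * h"
      using h by (simp add: left_diff_distrib[symmetric] abs_mult)
    then show ?thesis using h by simp
  qed
  then show ?thesis by blast
qed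

section \<open>Spatial slope of the limit\<close>

definition p :: "real \<Rightarrow> bool \<Rightarrow> real \<Rightarrow> real" where
  "p t i x = lim (\<lambda>n. pn n t i x)"

lemma pn_lim:
  assumes "0 \<le> t" "t \<le> S" "x \<ge> 0"
  shows "(\<lambda>n. pn n t i x) \<longlonglongrightarrow> p t i x"
proof -
  have "Cauchy (\<lambda>n. pn n t i x)"
  proof (rule metric_CauchyI)
    fix e :: real assume "e > 0"
    then have "e / 2 > 0" by simp
    from pn_Cauchy[OF this, of x] obtain N where
      "\<And>m n. m \<ge> N \<Longrightarrow> n \<ge> N \<Longrightarrow> \<bar>pn m t i x - pn n t i x\<bar> \<le> e / 2"
      using assms by blast
    then show "\<exists>N. \<forall>m\<ge>N. \<forall>n\<ge>N. dist (pn m t i x) (pn n t i x) < e"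
      using \<open>e > 0\<close> by (intro exI[of _ N]) (force simp: dist_real_def)
  qed
  then show ?thesis unfolding p_def by (simp add: Cauchy_convergent convergent_LIMSEQ_iff[symmetric])
qed

lemma pn_uniform_limit:
  assumes "e > 0"
  shows "\<exists>N. \<forall>n\<ge>N. \<forall>t x i. 0 \<le> t \<longrightarrow> t \<le> S \<longrightarrow> 0 \<le> x \<longrightarrow> x \<le> R \<longrightarrow> \<bar>p t i x - pn n t i x\<bar> \<le> e"
proof -
  obtain N where N: "\<And>m n t x i. m \<ge> N \<Longrightarrow> n \<ge> N \<Longrightarrow> 0 \<le> t \<Longrightarrow> t \<le> S \<Longrightarrow> 0 \<le> x \<Longrightarrow> x \<le> R \<Longrightarrow>
      \<bar>pn m t i x - pn n t i x\<bar> \<le> e"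
    using pn_Cauchy[OF assms, of R] by blast
  have "\<bar>p t i x - pn n t i x\<bar> \<le> e" if "n \<ge> N" "0 \<le> t" "t \<le> S" "0 \<le> x" "x \<le> R" for n t x i
  proof (rule LIMSEQ_le_const2)
    show "(\<lambda>m. \<bar>pn m t i x - pn n t i x\<bar>) \<longlonglongrightarrow> \<bar>p t i x - pn n t i x\<bar>"
      using that by (intro tendsto_intros pn_lim) auto
    show "\<exists>N. \<forall>m\<ge>N. \<bar>pn m t i x - pn n t i x\<bar> \<le> e" using N that by blast
  qed
  then show ?thesis by blast
qed

lemma p_bounds:
  assumes "0 \<le> t" "t \<le> S" "x \<ge> 0"
  shows "0 \<le> p t i x" "p t i x \<le> M"
  by (rule LIMSEQ_le_const[OF pn_lim[OF assms]], use pn_bounds[OF assms] in blast)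
     (rule LIMSEQ_le_const2[OF pn_lim[OF assms]], use pn_bounds[OF assms] in blast)

text \<open>Inherited from \<open>zs_Taylor\<close> by pointwise limits. Being uniform in t and
  locally uniform in x, it yields differentiability in x as well as continuity of p.\<close>

lemma z_Taylor:
  assumes "e > 0"
  obtains \<delta> where "\<delta> > 0" "\<And>t i x y. \<lbrakk>0 \<le> t; t \<le> S;
     0 \<le> x; x \<le> R; 0 \<le> y; y \<le> R; \<bar>x - y\<bar> \<le> \<delta>\<rbrakk> \<Longrightarrow>
     \<bar>z t i y - z t i x - p t i x * (y - x)\<bar> \<le> e * \<bar>y - x\<bar>"
proof -
  obtain \<delta> where \<delta>: "\<delta> > 0" "\<And>d k i x y. \<lbrakk>d > 0; d * M \<le> 1; real k * d \<le> S;
     0 \<le> x; x \<le> R; 0 \<le> y; y \<le> R; \<bar>x - y\<bar> \<le> \<delta>\<rbrakk> \<Longrightarrow>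
     \<bar>zs d k i y - zs d k i x - ps d k i x * (y - x)\<bar> \<le> e * \<bar>y - x\<bar>"
    using zs_Taylor[OF assms, of R] by blast
  show thesis
  proof (rule that[OF \<delta>(1)])
    fix t i x y assume *: "0 \<le> t" "t \<le> S" "0 \<le> x" "x \<le> R" "0 \<le> y" "y \<le> R" "\<bar>x - y\<bar> \<le> \<delta>"
    have "\<bar>zn n t i y - zn n t i x - pn n t i x * (y - x)\<bar> \<le> e * \<bar>y - x\<bar>" for n
      unfolding zn_def pn_def by (rule \<delta>(2)[OF ds_pos ds_M idx_le]) (use * in auto)
    moreover have "(\<lambda>n. \<bar>zn n t i y - zn n t i x - pn n t i x * (y - x)\<bar>) \<longlonglongrightarrow>
        \<bar>z t i y - z t i x - p t i x * (y - x)\<bar>"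
      using * by (intro tendsto_intros zn_lim pn_lim) auto
    ultimately show "\<bar>z t i y - z t i x - p t i x * (y - x)\<bar> \<le> e * \<bar>y - x\<bar>"
      by (intro LIMSEQ_le_const2) auto
  qed
qed

lemma z_x_deriv:
  assumes "0 \<le> t" "t \<le> S" "x \<ge> 0"
  shows "(z t i has_real_derivative p t i x) (at x within {0..})"
  unfolding has_field_derivative_def has_derivative_within_alt
proof (intro conjI allI impI)
  show "bounded_linear ((*) (p t i x))" by (rule bounded_linear_mult_right)
  fix e :: real assume "e > 0"
  then obtain \<delta> where \<delta>: "\<delta> > 0" "\<And>t i x' y. \<lbrakk>0 \<le> t; t \<le> S;
     0 \<le> x'; x' \<le> x + 1; 0 \<le> y; y \<le> x + 1; \<bar>x' - y\<bar> \<le> \<delta>\<rbrakk> \<Longrightarrow>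
     \<bar>z t i y - z t i x' - p t i x' * (y - x')\<bar> \<le> e * \<bar>y - x'\<bar>"
    using z_Taylor[of e "x + 1"] by blast
  then show "\<exists>d>0. \<forall>y\<in>{0..}. norm (y - x) < d \<longrightarrow> norm (z t i y - z t i x - p t i x * (y - x)) \<le> e * norm (y - x)"
    using assms by (intro exI[of _ "min \<delta> 1"]) auto
qed

text \<open>p is compared with a difference quotient of z of fixed width h, which is Lipschitz in
  (t, x).\<close>

lemma p_continuous: "continuous_on ({0..S} \<times> {0..}) (\<lambda>(t, x). p t i x)"
  unfolding continuous_on_iff
proof (clarify)
  fix t x e :: real assume *: "t \<in> {0..S}" "0 \<le> x" "e > 0"
  have "e / 8 > 0" using * by simp
  then obtain \<delta> where \<delta>: "\<delta> > 0" "\<And>t i x' y. \<lbrakk>0 \<le> t; t \<le> S;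
     0 \<le> x'; x' \<le> x + 2; 0 \<le> y; y \<le> x + 2; \<bar>x' - y\<bar> \<le> \<delta>\<rbrakk> \<Longrightarrow>
     \<bar>z t i y - z t i x' - p t i x' * (y - x')\<bar> \<le> e / 8 * \<bar>y - x'\<bar>"
    using z_Taylor[of "e/8" "x + 2"] by blast
  define h where "h = min \<delta> 1"
  have h: "h > 0" "h \<le> \<delta>" "h \<le> 1" using \<delta> by (auto simp: h_def)
  \<comment> \<open>The bound 1 keeps x' + h below x + 2; the other makes each of the two Lipschitz
    errors at most e h / 8. With two Taylor errors of the same size the total is e h / 2.\<close>
  define r where "r = min 1 (e * h / (8 * (V + M + 1)))"
  have VM: "V + M + 1 > 0" using LMV_nonneg by simp
  have r: "r > 0" "r \<le> 1" "(V + M + 1) * r \<le> e * h / 8"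
  proof -
    show "r > 0" "r \<le> 1" using * h VM by (auto simp: r_def)
    have "r \<le> e * h / (8 * (V + M + 1))" by (simp add: r_def)
    then show "(V + M + 1) * r \<le> e * h / 8" using VM by (simp add: field_simps)
  qed
  show "\<exists>d>0. \<forall>x'\<in>{0..S} \<times> {0..}. dist x' (t, x) < d \<longrightarrow>
      dist (case x' of (t, x) \<Rightarrow> p t i x) (p t i x) < e"
  proof (intro exI[of _ r] conjI ballI impI r(1))
    fix q assume q: "q \<in> {0..S} \<times> {0..}" "dist q (t, x) < r"
    obtain t' x' where q': "q = (t', x')" by force
    have "\<bar>t' - t\<bar> < r" "\<bar>x' - x\<bar> < r"
      using q(2) dist_fst_le[of q "(t, x)"] dist_snd_le[of q "(t, x)"] by (auto simp: q' dist_real_def)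
    note q = q this
    have "V * \<bar>t' - t\<bar> \<le> V * r" "M * \<bar>x' - x\<bar> \<le> M * r"
      using q LMV_nonneg by (auto intro!: mult_left_mono)
    then have L: "V * \<bar>t' - t\<bar> + M * \<bar>x' - x\<bar> \<le> e * h / 8"
      using r by (simp add: algebra_simps)
    have 1: "\<bar>z t' i x' - z t i x\<bar> \<le> e * h / 8"
      using z_Lipschitz[of t' t x' x i] q L * by (auto simp: q')
    have 2: "\<bar>z t' i (x' + h) - z t i (x + h)\<bar> \<le> e * h / 8"
      using z_Lipschitz[of t' t "x' + h" "x + h" i] q L * h by (auto simp: q')
    have 3: "\<bar>z t i (x + h) - z t i x - p t i x * h\<bar> \<le> e / 8 * h"
      using \<delta>(2)[of t x "x + h" i] * h by auto
    have 4: "\<bar>z t' i (x' + h) - z t' i x' - p t' i x' * h\<bar> \<le> e / 8 * h"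
      using \<delta>(2)[of t' x' "x' + h" i] * h q r by (auto simp: q')
    have "\<bar>p t' i x' * h - p t i x * h\<bar> \<le> e * h / 2" using 1 2 3 4 by linarith
    then have "\<bar>p t' i x' - p t i x\<bar> * h \<le> (e / 2) * h"
      using h by (simp add: left_diff_distrib[symmetric] abs_mult)
    then have "\<bar>p t' i x' - p t i x\<bar> \<le> e / 2" using h by (simp del: times_divide_eq_left)
    then show "dist (case q of (t, x) \<Rightarrow> p t i x) (p t i x) < e"
      using * by (simp add: q' dist_real_def)
  qed
qed

lemma z_continuous: "continuous_on ({0..S} \<times> {0..}) (\<lambda>(t, x). z t i x)"
  unfolding continuous_on_iff
proof (clarify)
  fix t x e :: real assume *: "t \<in> {0..S}" "0 \<le> x" "e > 0"
  have VM: "V + M + 1 > 0" using LMV_nonneg by simp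
  define r where "r = e / (V + M + 1)"
  have r: "r > 0" "(V + M + 1) * r = e" using VM * by (auto simp: r_def)
  show "\<exists>d>0. \<forall>x'\<in>{0..S} \<times> {0..}. dist x' (t, x) < d \<longrightarrow>
      dist (case x' of (t, x) \<Rightarrow> z t i x) (z t i x) < e"
  proof (intro exI[of _ r] conjI ballI impI r(1))
    fix q assume q: "q \<in> {0..S} \<times> {0..}" "dist q (t, x) < r"
    obtain t' x' where q': "q = (t', x')" by force
    have "\<bar>t' - t\<bar> < r" "\<bar>x' - x\<bar> < r"
      using q(2) dist_fst_le[of q "(t, x)"] dist_snd_le[of q "(t, x)"] by (auto simp: q' dist_real_def)
    note q = q this
    have "V * \<bar>t' - t\<bar> \<le> V * r" "M * \<bar>x' - x\<bar> \<le> M * r"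
      using q LMV_nonneg by (auto intro!: mult_left_mono)
    moreover have "\<bar>z t' i x' - z t i x\<bar> \<le> V * \<bar>t' - t\<bar> + M * \<bar>x' - x\<bar>"
      using z_Lipschitz[of t' t x' x i] q * by (auto simp: q')
    ultimately have "\<bar>z t' i x' - z t i x\<bar> < e" using r by (simp add: algebra_simps)
    then show "dist (case q of (t, x) \<Rightarrow> z t i x) (z t i x) < e"
      by (simp add: q' dist_real_def)
  qed
qed

section \<open>Time derivative of the limit and the transport equation\<close>

definition G :: "real \<Rightarrow> bool \<Rightarrow> real \<Rightarrow> real" where
  "G t i x = F x - wave_speed (\<lambda>j. z t j x) i * p t i x"

text \<open>At a fixed x, a step of the scheme is nearly an Euler step in time, uniformly in k:
  Taylor expansion about x turns the shift to the foot into -d w times the slope, and then w and the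
  slope are replaced by their limits.\<close>

lemma zs_consistent:
  assumes "x \<ge> 0" "e > 0"
  shows "\<forall>\<^sub>F n in sequentially. \<forall>k. real (Suc k) * ds n \<le> S \<longrightarrow>
    \<bar>zs (ds n) (Suc k) i x - zs (ds n) k i x - ds n * G (real k * ds n) i x\<bar> \<le> e * ds n"
proof -
  \<comment> \<open>Chosen so that L e1 <= e / 4; the summand 1 avoids division by 0.\<close>
  define e1 where "e1 = e / 4 / (L + 1)"
  have L1: "L + 1 > 0" using LMV_nonneg by simp
  have "(L + 1) * e1 = e / 4" using L1 unfolding e1_def by (metis less_irrefl nonzero_mult_div_cancel_left times_divide_eq_right)
  moreover have "e1 > 0" using L1 assms by (simp add: e1_def)
  ultimately have e1: "e1 > 0" "(L + 1) * e1 = e / 4" by auto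
  then have e1L: "e1 * L \<le> e / 4" by (simp add: algebra_simps)
  obtain \<delta> where \<delta>: "\<delta> > 0" "\<And>d k i x' y. \<lbrakk>d > 0; d * M \<le> 1; real k * d \<le> S;
     0 \<le> x'; x' \<le> x + 1; 0 \<le> y; y \<le> x + 1; \<bar>x' - y\<bar> \<le> \<delta>\<rbrakk> \<Longrightarrow>
     \<bar>zs d k i y - zs d k i x' - ps d k i x' * (y - x')\<bar> \<le> e1 * \<bar>y - x'\<bar>"
    using zs_Taylor[OF e1(1), of "x + 1"] by blast
  have "\<forall>\<^sub>F n in sequentially. L * ds n \<le> min \<delta> 1" using \<delta> by (intro eventually_ds_le) auto
  moreover have "\<forall>\<^sub>F n in sequentially. (Dz * M) * ds n \<le> e / 4" using assms by (intro eventually_ds_le) auto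
  moreover have "\<forall>\<^sub>F n in sequentially. \<forall>t x' i. 0 \<le> t \<longrightarrow> t \<le> S \<longrightarrow> 0 \<le> x' \<longrightarrow> x' \<le> x \<longrightarrow> \<bar>p t i x' - pn n t i x'\<bar> \<le> e1"
    using pn_uniform_limit[OF e1(1), of x] unfolding eventually_sequentially by blast
  ultimately show ?thesis
  proof eventually_elim
    case (elim n)
    show ?case
    proof (intro allI impI)
      fix k assume k: "real (Suc k) * ds n \<le> S"
      define d where "d = ds n"
      define t where "t = real k * d"
      have d: "d > 0" "d * M \<le> 1" "real k * d \<le> S" using ds_pos[of n] ds_M k by (auto simp: d_def algebra_simps)
      have t: "0 \<le> t" "t \<le> S" using d by (auto simp: t_def)
      have idx: "idx n t = k" by (simp add: t_def d_def)
      define f where "f = foot d k i x"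
      define w where "w = wave_speed (\<lambda>j. zs d k j x) i"
      define w' where "w' = wave_speed (\<lambda>j. z t j x) i"
      have f: "x \<le> f" "f \<le> x + d * L" using foot_bounds[OF d(1,3) assms(1)] by (auto simp: f_def)
      have fx: "f - x = - (d * w)" by (simp add: f_def foot_def w_def)
      have Ld: "d * L \<le> \<delta>" "d * L \<le> 1" using elim(1) by (auto simp: d_def mult.commute)
      have "\<bar>zs d k i f - zs d k i x - ps d k i x * (f - x)\<bar> \<le> e1 * \<bar>f - x\<bar>"
        using f Ld assms by (intro \<delta>(2)[OF d]) auto
      also have "\<dots> \<le> e1 * (d * L)" using f e1 by (intro mult_left_mono) auto
      also have "\<dots> \<le> d * (e / 4)"
        using mult_left_mono[OF e1L, of d] d by (simp add: ac_simps)
      finally have 1: "\<bar>zs d k i f - zs d k i x - ps d k i x * (f - x)\<bar> \<le> d * (e / 4)" .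
      have "\<bar>z t j x - zs d k j x\<bar> \<le> Dz * d" for j
        using zn_lim(2)[OF t assms(1), of j n] by (simp add: zn_def idx d_def)
      then have ww: "\<bar>w' - w\<bar> \<le> Dz * d" unfolding w_def w'_def by (rule wave_speed_dist_le)
      have pp: "\<bar>p t i x - ps d k i x\<bar> \<le> e1"
        using elim(3) t assms by (auto simp: pn_def idx d_def)
      have "w \<le> 0" "- L \<le> w" using zs_bounds[OF d(1,3) assms(1)]
        by (auto simp: w_def intro!: wave_speed_le wave_speed_ge)
      then have wL: "\<bar>w\<bar> \<le> L" by simp
      have pM: "\<bar>p t i x\<bar> \<le> M" using p_bounds[OF t assms(1)] by simp
      have "\<bar>(w' - w) * p t i x\<bar> \<le> (Dz * d) * M"
        unfolding abs_mult using ww pM order_trans[OF abs_ge_zero ww] by (intro mult_mono) auto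
      moreover have "\<bar>w * (p t i x - ps d k i x)\<bar> \<le> L * e1"
        unfolding abs_mult using wL pp LMV_nonneg by (intro mult_mono) auto
      moreover have "(Dz * d) * M \<le> e / 4" using elim(2) by (simp add: d_def ac_simps)
      moreover have "w' * p t i x - w * ps d k i x = (w' - w) * p t i x + w * (p t i x - ps d k i x)"
        by (simp add: algebra_simps)
      moreover have "L * e1 \<le> e / 4" using e1L by (simp add: mult.commute)
      ultimately have "\<bar>w' * p t i x - w * ps d k i x\<bar> \<le> e / 2" by linarith
      then have "d * \<bar>w' * p t i x - w * ps d k i x\<bar> \<le> d * (e / 2)"
        using d by (intro mult_left_mono) auto
      moreover have "\<bar>d\<bar> = d" using d by simp
      ultimately have 2: "\<bar>d * (w' * p t i x - w * ps d k i x)\<bar> \<le> d * (e / 2)"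
        by (simp only: abs_mult)
      have "zs d (Suc k) i x - zs d k i x - d * G t i x =
        (zs d k i f - zs d k i x - ps d k i x * (f - x)) + d * (w' * p t i x - w * ps d k i x)"
        unfolding zs_Suc G_def fx w'_def[symmetric] f_def[symmetric] by (simp add: algebra_simps)
      then have "\<bar>zs d (Suc k) i x - zs d k i x - d * G t i x\<bar> \<le> d * (e / 4) + d * (e / 2)"
        using 1 2 by linarith
      also have "\<dots> \<le> e * d" using d assms by (simp add: field_simps)
      finally show "\<bar>zs (ds n) (Suc k) i x - zs (ds n) k i x - ds n * G (real k * ds n) i x\<bar> \<le> e * ds n"
        by (simp add: d_def t_def)
    qed
  qed
qed

lemma G_continuous:
  assumes "x \<ge> 0"
  shows "continuous_on {0..S} (\<lambda>t. G t i x)"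
proof -
  have "continuous_on {0..S} (\<lambda>t. (\<lambda>(t, x). z t j x) (t, x))" for j
    by (rule continuous_on_compose2[OF z_continuous]) (use assms in \<open>auto intro!: continuous_intros\<close>)
  moreover have "continuous_on {0..S} (\<lambda>t. (\<lambda>(t, x). p t j x) (t, x))" for j
    by (rule continuous_on_compose2[OF p_continuous]) (use assms in \<open>auto intro!: continuous_intros\<close>)
  ultimately show ?thesis unfolding G_def wave_speed_def by (auto intro!: continuous_intros)
qed

text \<open>The Euler steps between t and t' are summed; half of e covers consistency, the other
  half the oscillation of G near t0. Leaving both ends free serves increments to the left and to the
  right of t0 at once.\<close>

lemma z_increment:
  assumes "x \<ge> 0" "0 \<le> t0" "t0 \<le> S" "e > 0"
  obtains \<delta> where "\<delta> > 0" "\<And>t t'. \<lbrakk>0 \<le> t; t \<le> t'; t' \<le> S; \<bar>t - t0\<bar> \<le> \<delta>; \<bar>t' - t0\<bar> \<le> \<delta>\<rbrakk> \<Longrightarrow>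
     \<bar>z t' i x - z t i x - (t' - t) * G t0 i x\<bar> \<le> e * (t' - t)"
proof -
  define g where "g = G t0 i x"
  have "e / 2 > 0" using assms by simp
  then obtain \<delta>1 where \<delta>1: "\<delta>1 > 0" "\<And>t. 0 \<le> t \<Longrightarrow> t \<le> S \<Longrightarrow> \<bar>t - t0\<bar> < \<delta>1 \<Longrightarrow> \<bar>G t i x - g\<bar> < e / 2"
    using G_continuous[OF assms(1), of i] assms unfolding continuous_on_iff g_def
    by (metis atLeastAtMost_iff dist_real_def)
  \<comment> \<open>The grid time belonging to t may precede t by up to one step, itself at most
    \<delta>, so the grid times used stay within 2 \<delta> of t0.\<close>
  define \<delta> where "\<delta> = \<delta>1 / 3"
  have \<delta>: "\<delta> > 0" "2 * \<delta> < \<delta>1" using \<delta>1 by (auto simp: \<delta>_def)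
  show thesis
  proof (rule that[OF \<delta>(1)])
    fix t t' assume *: "0 \<le> t" "t \<le> t'" "t' \<le> S" "\<bar>t - t0\<bar> \<le> \<delta>" "\<bar>t' - t0\<bar> \<le> \<delta>"
    have t'0: "0 \<le> t'" "t \<le> S" using * by auto
    let ?D = "\<lambda>n. real (idx n t') * ds n - real (idx n t) * ds n"
    have "\<forall>\<^sub>F n in sequentially. 1 * ds n \<le> \<delta>" using \<delta> by (intro eventually_ds_le)
    moreover have "\<forall>\<^sub>F n in sequentially. \<forall>k. real (Suc k) * ds n \<le> S \<longrightarrow>
      \<bar>zs (ds n) (Suc k) i x - zs (ds n) k i x - ds n * G (real k * ds n) i x\<bar> \<le> e / 2 * ds n"
      using assms by (intro zs_consistent) auto
    ultimately have "\<forall>\<^sub>F n in sequentially. \<bar>zn n t' i x - zn n t i x - ?D n * g\<bar> \<le> e * ?D n"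
    proof eventually_elim
      case (elim n)
      have "\<bar>zs (ds n) l i x - zs (ds n) (idx n t) i x - (real l * ds n - real (idx n t) * ds n) * g\<bar>
         \<le> e * (real l * ds n - real (idx n t) * ds n)" if "idx n t \<le> l" "l \<le> idx n t'" for l
        using that
      proof (induction l rule: dec_induct)
        case base then show ?case by simp
      next
        case (step l)
        have "real (Suc l) * ds n \<le> real (idx n t') * ds n"
          using step.prems ds_pos[of n] by (intro mult_right_mono) auto
        also have "\<dots> \<le> t'" by (rule idx_bounds(1)[OF t'0(1)])
        finally have a: "real (Suc l) * ds n \<le> t'" .
        have "real (idx n t) * ds n \<le> real l * ds n"
          using step.hyps ds_pos[of n] by (intro mult_right_mono) auto
        then have b: "t - ds n \<le> real l * ds n"
          using idx_bounds(2)[OF *(1), of n] by (simp add: algebra_simps)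
        have c: "real l * ds n \<le> t'" using a ds_pos[of n] by (simp add: algebra_simps)
        have "\<bar>real l * ds n - t0\<bar> < \<delta>1" using b c elim(1) * \<delta> by linarith
        moreover have "0 \<le> real l * ds n" using ds_pos[of n] by simp
        ultimately have "\<bar>G (real l * ds n) i x - g\<bar> < e / 2" using \<delta>1(2) c * by simp
        then have "ds n * \<bar>G (real l * ds n) i x - g\<bar> \<le> ds n * (e / 2)"
          using ds_pos[of n] by (intro mult_left_mono) auto
        moreover have "\<bar>ds n\<bar> = ds n" using ds_pos[of n] by simp
        ultimately have "\<bar>ds n * (G (real l * ds n) i x - g)\<bar> \<le> ds n * (e / 2)"
          by (simp only: abs_mult)
        note 2 = this
        have 1: "\<bar>zs (ds n) (Suc l) i x - zs (ds n) l i x - ds n * G (real l * ds n) i x\<bar> \<le> e / 2 * ds n"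
          using elim(2) a * by auto
        have alg: "b' - a - (u + d - v) * g = (b - a - (u - v) * g) + (b' - b - d * G) + d * (G - g)"
          for a b b' u v d G :: real by (simp add: algebra_simps)
        have alg2: "e * (u - v) + e / 2 * d + d * (e / 2) = e * (u + d - v)" for u v d
          by (simp add: field_simps)
        have S: "real (Suc l) * ds n = real l * ds n + ds n" by (simp add: algebra_simps)
        have eq: "zs (ds n) (Suc l) i x - zs (ds n) (idx n t) i x - (real (Suc l) * ds n - real (idx n t) * ds n) * g =
          (zs (ds n) l i x - zs (ds n) (idx n t) i x - (real l * ds n - real (idx n t) * ds n) * g) +
          (zs (ds n) (Suc l) i x - zs (ds n) l i x - ds n * G (real l * ds n) i x) +
          ds n * (G (real l * ds n) i x - g)"
          unfolding S by (rule alg)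
        show ?case
          unfolding eq unfolding S alg2[symmetric]
          by (rule abs_triangle3_le[OF step.IH 1 2]) (use step.prems in simp)
      qed
      from this[OF idx_mono[OF *(2)] order_refl] show ?case by (simp add: zn_def)
    qed
    moreover have lim: "?D \<longlonglongrightarrow> t' - t" using * t'0 by (intro tendsto_intros idx_lim) auto
    moreover have "(\<lambda>n. \<bar>zn n t' i x - zn n t i x - ?D n * g\<bar>) \<longlonglongrightarrow> \<bar>z t' i x - z t i x - (t' - t) * g\<bar>"
      using assms * t'0 by (intro tendsto_intros zn_lim lim idx_lim) auto
    ultimately show "\<bar>z t' i x - z t i x - (t' - t) * G t0 i x\<bar> \<le> e * (t' - t)"
      unfolding g_def[symmetric]
      by (intro tendsto_le[OF _ tendsto_mult[OF tendsto_const lim]]) auto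
  qed
qed

lemma z_t_deriv:
  assumes "x \<ge> 0" "0 < t0" "t0 < S"
  shows "((\<lambda>t. z t i x) has_real_derivative G t0 i x) (at t0)"
proof -
  have "((\<lambda>t. z t i x) has_real_derivative G t0 i x) (at t0 within {0..S})"
    unfolding has_field_derivative_def has_derivative_within_alt
  proof (intro conjI allI impI)
    show "bounded_linear ((*) (G t0 i x))" by (rule bounded_linear_mult_right)
    fix e :: real assume e: "e > 0"
    obtain \<delta> where \<delta>: "\<delta> > 0" "\<And>t t'. \<lbrakk>0 \<le> t; t \<le> t'; t' \<le> S; \<bar>t - t0\<bar> \<le> \<delta>; \<bar>t' - t0\<bar> \<le> \<delta>\<rbrakk> \<Longrightarrow>
       \<bar>z t' i x - z t i x - (t' - t) * G t0 i x\<bar> \<le> e * (t' - t)"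
      using z_increment[OF assms(1) _ _ e, of t0 i] assms by auto
    have "\<bar>z t i x - z t0 i x - G t0 i x * (t - t0)\<bar> \<le> e * \<bar>t - t0\<bar>"
      if "0 \<le> t" "t \<le> S" "\<bar>t - t0\<bar> < \<delta>" for t
    proof (cases "t0 \<le> t")
      case True then show ?thesis using \<delta>(2)[of t0 t] assms that \<delta>(1) by (simp add: mult.commute)
    next
      case False
      then have "\<bar>z t0 i x - z t i x - (t0 - t) * G t0 i x\<bar> \<le> e * (t0 - t)"
        using \<delta>(2)[of t t0] assms that \<delta>(1) by simp
      moreover have "z t i x - z t0 i x - G t0 i x * (t - t0) = - (z t0 i x - z t i x - (t0 - t) * G t0 i x)"
        by (simp add: algebra_simps)
      ultimately show ?thesis using False by simp
    qed
    then show "\<exists>d>0. \<forall>y\<in>{0..S}. norm (y - t0) < d \<longrightarrow>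
        norm (z y i x - z t0 i x - G t0 i x * (y - t0)) \<le> e * norm (y - t0)"
      using \<delta>(1) by (intro exI[of _ \<delta>]) auto
  qed
  then show ?thesis using assms by (simp add: at_within_Icc_at)
qed

end

section \<open>Maximum principle\<close>

text \<open>The differential inequality is required only where the component is positive and
  dominates the other one, which lets coupling terms be absorbed into K. It is also required at the
  final time, with a two-sided time derivative, so the applications stop strictly before the
  horizon.\<close>

lemma maximum_principle:
  fixes W :: "bool \<Rightarrow> real \<Rightarrow> real \<Rightarrow> real"
  assumes cont: "\<And>i. continuous_on ({0..T} \<times> {0..}) (\<lambda>(t, x). W i t x)"
    and bdd: "\<And>i t x. 0 \<le> t \<Longrightarrow> t \<le> T \<Longrightarrow> 0 \<le> x \<Longrightarrow> W i t x \<le> D"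
    and init: "\<And>i x. 0 \<le> x \<Longrightarrow> W i 0 x \<le> 0"
    and ineq: "\<And>i t x. \<lbrakk>0 < t; t \<le> T; 0 \<le> x; W i t x > 0; \<And>j. W j t x \<le> W i t x\<rbrakk> \<Longrightarrow>
      \<exists>Wt Wx a. ((\<lambda>s. W i s x) has_real_derivative Wt) (at t) \<and>
        (W i t has_real_derivative Wx) (at x within {0..}) \<and>
        - \<Lambda> \<le> a \<and> a \<le> 0 \<and> Wt + a * Wx \<le> K * W i t x"
    and "\<Lambda> \<ge> 0" "0 \<le> t" "t \<le> T" "0 \<le> x"
  shows "W i t x \<le> 0"
proof (rule ccontr)
  assume "\<not> W i t x \<le> 0"
  then have pos: "W i t x > 0" by simp
  \<comment> \<open>Discounting by \<open>exp (- (K + 1) t)\<close> absorbs the growth rate; the linear penalty confines the maximum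
    to a compact set. At the maximum the transport derivative is nonnegative, also at the boundary
    \<open>x = 0\<close>, because the speed points out of the domain.\<close>
  define \<epsilon> where "\<epsilon> = exp (- (K + 1) * t) * W i t x / (2 * (x + \<Lambda> * t + 1))"
  have den: "x + \<Lambda> * t + 1 > 0" using assms by (smt (verit) mult_nonneg_nonneg)
  have \<epsilon>: "\<epsilon> > 0" using pos den by (simp add: \<epsilon>_def)
  \<comment> \<open>The summand \<Lambda> t offsets the transport of x: differentiating the penalty
    along speed a gives \<epsilon> (\<Lambda> + a) >= 0.\<close>
  define U where "U = (\<lambda>i t x. exp (- (K + 1) * t) * W i t x - \<epsilon> * (x + \<Lambda> * t + 1))"
  \<comment> \<open>By the choice of \<epsilon>, the penalty takes away exactly half of the positive
    value at (t, x).\<close>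
  have "\<epsilon> * (x + \<Lambda> * t + 1) = exp (- (K + 1) * t) * W i t x / 2"
    using den unfolding \<epsilon>_def by (simp add: field_simps)
  moreover have "exp (- (K + 1) * t) * W i t x > 0" using pos by (intro mult_pos_pos) auto
  ultimately have Upos: "U i t x > 0" unfolding U_def by linarith
  define D' where "D' = exp (\<bar>K + 1\<bar> * T) * max D 0"
  have D': "exp (- (K + 1) * s) * W j s y \<le> D'" if "0 \<le> s" "s \<le> T" "0 \<le> y" for j s y
  proof -
    have "- (K + 1) * s \<le> \<bar>K + 1\<bar> * T" using that by (intro mult_mono) auto
    then have "exp (- (K + 1) * s) * max D 0 \<le> D'" unfolding D'_def by (intro mult_right_mono) auto
    moreover have "exp (- (K + 1) * s) * W j s y \<le> exp (- (K + 1) * s) * max D 0"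
      using bdd[OF that, of j] by (intro mult_left_mono) auto
    ultimately show ?thesis by linarith
  qed
  \<comment> \<open>From D' / \<epsilon> on, the penalty outweighs the discounted W, so U is not
    positive there; R >= x keeps (t, x) in the box.\<close>
  define R where "R = max x (D' / \<epsilon>)"
  let ?B = "{0..T} \<times> {0..R}"
  have contU: "continuous_on ?B (\<lambda>(t, x). U j t x)" for j
  proof -
    have "continuous_on ?B (\<lambda>(t, x). W j t x)" by (rule continuous_on_subset[OF cont]) auto
    then show ?thesis unfolding U_def by (auto simp: case_prod_beta intro!: continuous_intros)
  qed
  have "compact ?B" by (intro compact_Times) auto
  moreover have tx: "(t, x) \<in> ?B" using assms by (auto simp: R_def)
  ultimately have "\<exists>q\<in>?B. \<forall>q'\<in>?B. (\<lambda>(t, x). U j t x) q' \<le> (\<lambda>(t, x). U j t x) q" for j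
    using contU[of j] by (intro continuous_attains_sup) auto
  then obtain q where q: "\<And>j. q j \<in> ?B" "\<And>j q'. q' \<in> ?B \<Longrightarrow> (\<lambda>(t, x). U j t x) q' \<le> (\<lambda>(t, x). U j t x) (q j)"
    by metis
  \<comment> \<open>The component with the larger maximum; at its maximum point it dominates the
    other one, as \<open>ineq\<close> demands.\<close>
  define k where "k \<longleftrightarrow> (\<lambda>(t, x). U True t x) (q True) \<ge> (\<lambda>(t, x). U False t x) (q False)"
  obtain s y where sy: "q k = (s, y)" by force
  have max: "U j s' y' \<le> U k s y" if "(s', y') \<in> ?B" for j s' y'
  proof -
    have "(\<lambda>(t, x). U j t x) (q j) \<le> (\<lambda>(t, x). U k t x) (q k)"
    proof (cases k)
      case True then show ?thesis using k_def by (cases j) auto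
    next
      case False then show ?thesis using k_def by (cases j) auto
    qed
    then show ?thesis using q(2)[OF that, of j] sy by auto
  qed
  have sB: "0 \<le> s" "s \<le> T" "0 \<le> y" "y \<le> R" using q(1)[of k] by (auto simp: sy)
  have Uk: "U k s y > 0" using max[OF tx, of i] Upos by linarith
  have lin: "\<epsilon> * (y + \<Lambda> * s + 1) > \<epsilon> * y" using \<epsilon> assms(5) sB by (smt (verit) mult_nonneg_nonneg mult_strict_left_mono)
  have "s \<noteq> 0"
  proof
    assume "s = 0"
    then have "U k s y \<le> - \<epsilon> * (y + 1)" using init[OF sB(3), of k] by (simp add: U_def)
    moreover have "\<epsilon> * (y + 1) \<ge> 0" using \<epsilon> sB by simp
    ultimately show False using Uk by simp
  qed
  then have s0: "s > 0" using sB by simp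
  have "y < R"
  proof (rule ccontr)
    assume "\<not> y < R"
    then have "y \<ge> D' / \<epsilon>" by (simp add: R_def)
    then have "\<epsilon> * y \<ge> D'" using \<epsilon> by (simp add: field_simps)
    then show False using D'[OF sB(1-3), of k] lin Uk by (simp add: U_def)
  qed
  have ex: "exp (- (K + 1) * s) > 0" by simp
  have Wmax: "W j s y \<le> W k s y" for j
  proof -
    have "U j s y \<le> U k s y" using max sB by auto
    then show ?thesis by (simp add: U_def)
  qed
  have "exp (- (K + 1) * s) * W k s y > 0" using Uk lin \<epsilon> sB by (smt (verit) U_def mult_nonneg_nonneg)
  then have Wk: "W k s y > 0" using ex by (simp only: zero_less_mult_pos)
  obtain Wt Wx a where W: "((\<lambda>s. W k s y) has_real_derivative Wt) (at s)"
    "(W k s has_real_derivative Wx) (at y within {0..})"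
    "- \<Lambda> \<le> a" "a \<le> 0" "Wt + a * Wx \<le> K * W k s y"
    using ineq[OF s0 sB(2,3) Wk Wmax] by blast
  define E where "E = exp (- (K + 1) * s)"
  define Ut where "Ut = E * (Wt - (K + 1) * W k s y) - \<epsilon> * \<Lambda>"
  define Ux where "Ux = E * Wx - \<epsilon>"
  have dt: "((\<lambda>s. U k s y) has_real_derivative Ut) (at s)"
    unfolding U_def Ut_def E_def using W(1) by (auto intro!: derivative_eq_intros simp: algebra_simps)
  have dx: "(U k s has_real_derivative Ux) (at y within {0..})"
    unfolding U_def Ux_def E_def using W(2) by (auto intro!: derivative_eq_intros simp: algebra_simps)
  \<comment> \<open>s may be the final time, so only earlier times are compared.\<close>
  have "Ut \<ge> 0"
  proof (rule ccontr)
    assume "\<not> Ut \<ge> 0"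
    then obtain d where d: "d > 0" "\<And>h. h > 0 \<Longrightarrow> h < d \<Longrightarrow> U k s y < U k (s - h) y"
      using DERIV_neg_dec_left[OF dt] by auto
    define h where "h = min (d / 2) s"
    have "h > 0" "h < d" "h \<le> s" using d s0 by (auto simp: h_def)
    then show False using d(2)[of h] max[of "s - h" y k] sB by auto
  qed
  \<comment> \<open>y may be 0, so only larger points are compared; the sign of a makes this
    direction sufficient.\<close>
  moreover have "Ux \<le> 0"
  proof (rule ccontr)
    assume "\<not> Ux \<le> 0"
    then obtain d where d: "d > 0" "\<And>h. h > 0 \<Longrightarrow> y + h \<in> {0..} \<Longrightarrow> h < d \<Longrightarrow> U k s y < U k s (y + h)"
      using has_real_derivative_pos_inc_right[OF dx] by auto
    define h where "h = min (d / 2) (R - y)"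
    have "h > 0" "h < d" "y + h \<le> R" using d \<open>y < R\<close> by (auto simp: h_def)
    then show False using d(2)[of h] max[of s "y + h" k] sB by auto
  qed
  then have "a * Ux \<ge> 0" using W(4) by (simp add: mult_nonpos_nonpos)
  moreover have "Ut + a * Ux = E * (Wt + a * Wx - (K + 1) * W k s y) - \<epsilon> * (\<Lambda> + a)"
    by (simp add: Ut_def Ux_def algebra_simps)
  moreover have "E * (Wt + a * Wx - (K + 1) * W k s y) < 0"
    using W(5) Wk by (intro mult_pos_neg) (auto simp: E_def algebra_simps)
  moreover have "\<epsilon> * (\<Lambda> + a) \<ge> 0" using \<epsilon> W(3) by simp
  ultimately show False by linarith
qed

section \<open>Derivatives on the half-line\<close>

text \<open>This makes derivatives within the half-line unique, also at the endpoint 0.\<close>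

lemma at_within_half_line_neq_bot:
  assumes "x \<ge> (0::real)"
  shows "at x within {0..} \<noteq> bot"
proof -
  have "at_right x \<le> at x within {0..}" using assms by (intro at_le) auto
  then show ?thesis using trivial_limit_at_right_real[of x] by (metis bot.extremum_uniqueI)
qed

lemma hderiv_eq:
  assumes "(f has_real_derivative D) (at x within {0..})" "x \<ge> 0"
  shows "hderiv f x = D"
  unfolding hderiv_def using assms
  by (intro vector_derivative_within at_within_half_line_neq_bot)
     (auto simp: has_real_derivative_iff_has_vector_derivative)

lemma has_hderiv:
  assumes "f differentiable (at x within {0..})" "x \<ge> 0"
  shows "(f has_real_derivative hderiv f x) (at x within {0..})"
  using assms hderiv_eq unfolding real_differentiable_def by metis

section \<open>An algebra of bounded continuous fields, and membership in \<open>C11\<close>\<close>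

definition bounded_cont :: "real \<Rightarrow> (real \<Rightarrow> real \<Rightarrow> real) \<Rightarrow> bool" where
  "bounded_cont T f \<longleftrightarrow>
     continuous_on (Omega T) (\<lambda>(t, x). f t x) \<and> bounded ((\<lambda>(t, x). f t x) ` Omega T)"

lemma bounded_contI:
  assumes "continuous_on (Omega T) (\<lambda>(t, x). f t x)"
    "\<And>t x. (t, x) \<in> Omega T \<Longrightarrow> \<bar>f t x\<bar> \<le> B"
  shows "bounded_cont T f"
  using assms unfolding bounded_cont_def by (auto intro!: boundedI[where B = B])

lemma bounded_contE:
  assumes "bounded_cont T f"
  obtains B where "B > 0" "\<And>t x. (t, x) \<in> Omega T \<Longrightarrow> \<bar>f t x\<bar> \<le> B"
  using assms that unfolding bounded_cont_def bounded_pos by (auto simp: case_prod_beta) (metis fst_conv snd_conv)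

lemma bounded_cont_const: "bounded_cont T (\<lambda>t x. c)"
  by (rule bounded_contI[where B = "\<bar>c\<bar>"]) (auto simp: case_prod_beta)

lemma bounded_cont_add:
  assumes "bounded_cont T f" "bounded_cont T g"
  shows "bounded_cont T (\<lambda>t x. f t x + g t x)"
proof -
  obtain A B where "\<And>t x. (t, x) \<in> Omega T \<Longrightarrow> \<bar>f t x\<bar> \<le> A" "\<And>t x. (t, x) \<in> Omega T \<Longrightarrow> \<bar>g t x\<bar> \<le> B"
    using assms by (metis bounded_contE)
  then show ?thesis using assms unfolding bounded_cont_def
    by (intro bounded_contI[where B = "A + B", unfolded bounded_cont_def])
       (force simp: case_prod_beta intro!: continuous_intros)+
qed

lemma bounded_cont_mult:
  assumes "bounded_cont T f" "bounded_cont T g"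
  shows "bounded_cont T (\<lambda>t x. f t x * g t x)"
proof -
  obtain A where A: "A > 0" "\<And>t x. (t, x) \<in> Omega T \<Longrightarrow> \<bar>f t x\<bar> \<le> A"
    using assms by (metis bounded_contE)
  obtain B where B: "B > 0" "\<And>t x. (t, x) \<in> Omega T \<Longrightarrow> \<bar>g t x\<bar> \<le> B"
    using assms by (metis bounded_contE)
  show ?thesis
  proof (rule bounded_contI[where B = "A * B"])
    show "continuous_on (Omega T) (\<lambda>(t, x). f t x * g t x)"
      using assms by (auto simp: bounded_cont_def case_prod_beta intro!: continuous_intros)
    show "\<bar>f t x * g t x\<bar> \<le> A * B" if "(t, x) \<in> Omega T" for t x
      using A B that unfolding abs_mult by (intro mult_mono) auto
  qed
qed

lemma bounded_cont_diff:
  assumes "bounded_cont T f" "bounded_cont T g"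
  shows "bounded_cont T (\<lambda>t x. f t x - g t x)"
  using bounded_cont_add[OF assms(1) bounded_cont_mult[OF bounded_cont_const[of T "-1"] assms(2)]] by simp

lemmas bounded_cont_intros = bounded_cont_const bounded_cont_add bounded_cont_mult bounded_cont_diff

lemma bounded_cont_space:
  assumes "continuous_on {0..} f" "\<And>x. x \<ge> 0 \<Longrightarrow> \<bar>f x\<bar> \<le> B"
  shows "bounded_cont T (\<lambda>t x. f x)"
proof (rule bounded_contI[where B = B])
  have "continuous_on (Omega T) (\<lambda>q. f (snd q))"
    by (rule continuous_on_compose2[OF assms(1)]) (auto simp: Omega_def intro!: continuous_intros)
  then show "continuous_on (Omega T) (\<lambda>(t, x). f x)" by (simp add: case_prod_beta)
qed (use assms(2) in \<open>auto simp: Omega_def\<close>)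

lemma C11I:
  assumes "\<And>t x. (t, x) \<in> Omega T \<Longrightarrow> ((\<lambda>s. f s x) has_real_derivative ft t x) (at t)"
    and "\<And>t x. (t, x) \<in> Omega T \<Longrightarrow> (f t has_real_derivative fx t x) (at x within {0..})"
    and "bounded_cont T f" "bounded_cont T ft" "bounded_cont T fx"
  shows "f \<in> C11 T"
proof -
  have t: "pt f t x = ft t x" if "(t, x) \<in> Omega T" for t x
    unfolding pt_def using assms(1)[OF that] by (rule DERIV_imp_deriv)
  have x: "px f t x = fx t x" if "(t, x) \<in> Omega T" for t x
    unfolding px_def using assms(2)[OF that] that by (intro hderiv_eq) (auto simp: Omega_def)
  have "continuous_on (Omega T) (\<lambda>(t, x). pt f t x)" "bounded ((\<lambda>(t, x). pt f t x) ` Omega T)"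
    using assms(4) unfolding bounded_cont_def
    by (metis (mono_tags, lifting) continuous_on_cong image_cong t case_prod_conv prod.collapse)+
  moreover have "continuous_on (Omega T) (\<lambda>(t, x). px f t x)" "bounded ((\<lambda>(t, x). px f t x) ` Omega T)"
    using assms(5) unfolding bounded_cont_def
    by (metis (mono_tags, lifting) continuous_on_cong image_cong x case_prod_conv prod.collapse)+
  moreover have "(\<lambda>s. f s x) differentiable (at t)" "f t differentiable (at x within {0..})"
    if "(t, x) \<in> Omega T" for t x
    using assms(1,2)[OF that] unfolding real_differentiable_def by blast+
  ultimately show ?thesis using assms(3) unfolding C11_def bounded_cont_def by auto
qed

lemma C11D:
  assumes "f \<in> C11 T"
  shows "\<And>t x. (t, x) \<in> Omega T \<Longrightarrow> ((\<lambda>s. f s x) has_real_derivative pt f t x) (at t)"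
    and "\<And>t x. (t, x) \<in> Omega T \<Longrightarrow> (f t has_real_derivative px f t x) (at x within {0..})"
    and "\<exists>B>0. \<forall>t x. (t, x) \<in> Omega T \<longrightarrow> \<bar>f t x\<bar> \<le> B \<and> \<bar>px f t x\<bar> \<le> B"
proof -
  show "((\<lambda>s. f s x) has_real_derivative pt f t x) (at t)" if "(t, x) \<in> Omega T" for t x
    using assms that unfolding C11_def pt_def by (auto simp: DERIV_deriv_iff_real_differentiable)
  show "(f t has_real_derivative px f t x) (at x within {0..})" if "(t, x) \<in> Omega T" for t x
    using assms that unfolding C11_def px_def by (intro has_hderiv) (auto simp: Omega_def)
  obtain A where A: "\<And>t x. (t, x) \<in> Omega T \<Longrightarrow> \<bar>f t x\<bar> \<le> A"
    using assms unfolding C11_def bounded_iff by fastforce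
  obtain B where B: "\<And>t x. (t, x) \<in> Omega T \<Longrightarrow> \<bar>px f t x\<bar> \<le> B"
    using assms unfolding C11_def bounded_iff by fastforce
  show "\<exists>B>0. \<forall>t x. (t, x) \<in> Omega T \<longrightarrow> \<bar>f t x\<bar> \<le> B \<and> \<bar>px f t x\<bar> \<le> B"
    using A B by (intro exI[of _ "max 1 (max A B)"]) (auto simp: le_max_iff_disj)
qed

section \<open>Riemann invariants of the shallow-water system\<close>

lemma Cb_1D:
  assumes "f \<in> Cb 1"
  shows "\<And>x. x \<ge> 0 \<Longrightarrow> (f has_real_derivative hderiv f x) (at x within {0..})"
    and "continuous_on {0..} f" "continuous_on {0..} (hderiv f)"
    and "\<exists>B. \<forall>x\<ge>0. \<bar>f x\<bar> \<le> B \<and> \<bar>hderiv f x\<bar> \<le> B"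
proof -
  have *: "(\<forall>x\<ge>0. f differentiable (at x within {0..}))"
    "\<And>k. k \<le> 1 \<Longrightarrow> continuous_on {0..} ((hderiv ^^ k) f)"
    "\<And>k. k \<le> 1 \<Longrightarrow> bounded ((hderiv ^^ k) f ` {0..})"
    using assms unfolding Cb_def by auto
  show "\<And>x. x \<ge> 0 \<Longrightarrow> (f has_real_derivative hderiv f x) (at x within {0..})"
    using * has_hderiv by blast
  show "continuous_on {0..} f" "continuous_on {0..} (hderiv f)"
    using *(2)[of 0] *(2)[of 1] by auto
  obtain a b where "\<And>x. x \<ge> 0 \<Longrightarrow> \<bar>f x\<bar> \<le> a" "\<And>x. x \<ge> 0 \<Longrightarrow> \<bar>hderiv f x\<bar> \<le> b"
    using *(3)[of 0] *(3)[of 1] unfolding bounded_iff by auto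
  then show "\<exists>B. \<forall>x\<ge>0. \<bar>f x\<bar> \<le> B \<and> \<bar>hderiv f x\<bar> \<le> B"
    by (intro exI[of _ "max a b"]) (auto simp: le_max_iff_disj)
qed

lemma Cb_2D:
  assumes "f \<in> Cb 2"
  shows "f \<in> Cb 1" "hderiv f \<in> Cb 1"
proof -
  have *: "\<And>k x. k < 2 \<Longrightarrow> 0 \<le> x \<Longrightarrow> (hderiv ^^ k) f differentiable (at x within {0..})"
    "\<And>k. k \<le> 2 \<Longrightarrow> continuous_on {0..} ((hderiv ^^ k) f) \<and> bounded ((hderiv ^^ k) f ` {0..})"
    using assms unfolding Cb_def by auto
  show "f \<in> Cb 1" unfolding Cb_def using *(1)[of 0] *(2) by auto
  have "(hderiv ^^ k) (hderiv f) = (hderiv ^^ Suc k) f" for k by (simp add: funpow_swap1)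
  then show "hderiv f \<in> Cb 1" unfolding Cb_def using *(1)[of 1] *(2)[of "Suc _"] by auto
qed

locale supercritical_data =
  fixes u0 \<eta>0 h :: "real \<Rightarrow> real" and C :: real
  assumes u0: "u0 \<in> Cb 1" and \<eta>0: "\<eta>0 \<in> Cb 1" and h: "h \<in> Cb 2"
    and h_nonneg: "\<And>x. x \<ge> 0 \<Longrightarrow> h x \<ge> 0"
    and h'_nonpos: "\<And>x. x \<ge> 0 \<Longrightarrow> hderiv h x \<le> 0"
    and h''_nonneg: "\<And>x. x \<ge> 0 \<Longrightarrow> hderiv (hderiv h) x \<ge> 0"
    and C_pos: "C > 0"
    and \<eta>0_ge: "\<And>x. x \<ge> 0 \<Longrightarrow> \<eta>0 x \<ge> C"
    and u0_le: "\<And>x. x \<ge> 0 \<Longrightarrow> u0 x \<le> - 2 * sqrt (h x + \<eta>0 x)"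
    and u0'_ge: "\<And>x. x \<ge> 0 \<Longrightarrow>
           hderiv u0 x \<ge> \<bar>hderiv h x + hderiv \<eta>0 x\<bar> / sqrt (h x + \<eta>0 x)"
begin

definition sg :: "bool \<Rightarrow> real" where "sg i = (if i then 1 else - 1)"

lemma sg_simps [simp]: "sg True = 1" "sg False = - 1" "\<bar>sg i\<bar> = 1" "sg i * sg i = 1"
  "sg i * (sg i * r) = r"
  by (auto simp: sg_def)

definition z_init :: "bool \<Rightarrow> real \<Rightarrow> real" where
  "z_init i x = u0 x + sg i * (2 * sqrt (h x + \<eta>0 x))"

definition p_init :: "bool \<Rightarrow> real \<Rightarrow> real" where
  "p_init i x = hderiv u0 x + sg i * ((hderiv h x + hderiv \<eta>0 x) / sqrt (h x + \<eta>0 x))"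

text \<open>The hypotheses on u0 and u0' amount to |z_init - u0| <= -u0 and |p_init - u0'| <= u0'.
  Both signs follow, and the second inequality also bounds the slopes by 2 u0'.\<close>

lemma diagonal_system_exists:
  assumes "T > 0"
  obtains A B Z P where "diagonal_system (hderiv h) (hderiv (hderiv h)) z_init p_init T A B Z P"
proof -
  note h1 = Cb_1D[OF Cb_2D(1)[OF h]] and h2 = Cb_1D[OF Cb_2D(2)[OF h]]
    and u = Cb_1D[OF u0] and e = Cb_1D[OF \<eta>0]
  obtain Bh where Bh: "\<And>x. x \<ge> 0 \<Longrightarrow> \<bar>h x\<bar> \<le> Bh \<and> \<bar>hderiv h x\<bar> \<le> Bh" using h1(4) by blast
  obtain Bk where Bk: "\<And>x. x \<ge> 0 \<Longrightarrow> \<bar>hderiv h x\<bar> \<le> Bk \<and> \<bar>hderiv (hderiv h) x\<bar> \<le> Bk" using h2(4) by blast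
  obtain Bu where Bu: "\<And>x. x \<ge> 0 \<Longrightarrow> \<bar>u0 x\<bar> \<le> Bu \<and> \<bar>hderiv u0 x\<bar> \<le> Bu" using u(4) by blast
  obtain Be where Be: "\<And>x. x \<ge> 0 \<Longrightarrow> \<bar>\<eta>0 x\<bar> \<le> Be \<and> \<bar>hderiv \<eta>0 x\<bar> \<le> Be" using e(4) by blast
  have H: "h x + \<eta>0 x \<ge> C" "h x + \<eta>0 x > 0" if "x \<ge> 0" for x
    using h_nonneg[OF that] \<eta>0_ge[OF that] C_pos by auto
  have slope: "\<bar>(hderiv h x + hderiv \<eta>0 x) / sqrt (h x + \<eta>0 x)\<bar> \<le> hderiv u0 x" if "x \<ge> 0" for x
    using u0'_ge[OF that] H(2)[OF that] by (simp add: abs_divide)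
  have root: "0 \<le> 2 * sqrt (h x + \<eta>0 x)" "2 * sqrt (h x + \<eta>0 x) \<le> 2 * sqrt (Bh + Be)" if "x \<ge> 0" for x
    using H(2)[OF that] Bh[OF that] Be[OF that] by auto
  have "diagonal_system (hderiv h) (hderiv (hderiv h)) z_init p_init T Bk Bk (Bu + 2 * sqrt (Bh + Be)) (2 * Bu)"
  proof
    show "T > 0" by fact
    fix x :: real assume x: "x \<ge> 0"
    show "(hderiv h has_real_derivative hderiv (hderiv h) x) (at x within {0..})" using h2(1) x .
    show "- Bk \<le> hderiv h x" "hderiv (hderiv h) x \<le> Bk" using Bk[OF x] by auto
    show "hderiv h x \<le> 0" "0 \<le> hderiv (hderiv h) x" using h'_nonpos h''_nonneg x by auto
    fix i
    show "(z_init i has_real_derivative p_init i x) (at x within {0..})"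
      unfolding z_init_def p_init_def using H(2)[OF x]
      by (auto intro!: derivative_eq_intros h1(1) u(1) e(1) x simp: field_simps)
    have "\<bar>z_init i x - u0 x\<bar> \<le> 2 * sqrt (h x + \<eta>0 x)"
      using root[OF x] unfolding z_init_def by (simp add: abs_mult[of "sg i"])
    then show "z_init i x \<le> 0" "- (Bu + 2 * sqrt (Bh + Be)) \<le> z_init i x"
      using u0_le[OF x] root[OF x] Bu[OF x] by linarith+
    have "\<bar>p_init i x - hderiv u0 x\<bar> \<le> hderiv u0 x"
      using slope[OF x] unfolding p_init_def by (simp add: abs_mult[of "sg i"])
    then show "0 \<le> p_init i x" "p_init i x \<le> 2 * Bu"
      using Bu[OF x] by linarith+
  next
    show "continuous_on {0..} (hderiv (hderiv h))" by (rule h2(3))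
    show "continuous_on {0..} (p_init i)" for i
      unfolding p_init_def using H(2)
      by (intro continuous_intros h1 u e) (auto simp: less_imp_neq[symmetric])
  qed
  then show thesis by (rule that)
qed

text \<open>The Riemann invariants are \<open>z t True = u + 2 c\<close> and \<open>z t False = u - 2 c\<close>, where \<open>c\<close> is the
  square root of the total depth \<open>h + \<eta>\<close>.\<close>

lemma Riemann_invariants:
  assumes "T > 0"
  obtains z p :: "real \<Rightarrow> bool \<Rightarrow> real \<Rightarrow> real" and L M :: real where
    "\<And>t x i. \<lbrakk>0 \<le> t; t \<le> T; 0 \<le> x\<rbrakk> \<Longrightarrow> - L \<le> z t i x \<and> z t i x \<le> 0 \<and> 0 \<le> p t i x \<and> p t i x \<le> M"
    "\<And>t x i. \<lbrakk>0 \<le> t; t \<le> T; 0 \<le> x\<rbrakk> \<Longrightarrow> (z t i has_real_derivative p t i x) (at x within {0..})"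
    "\<And>t x i. \<lbrakk>0 < t; t < T; 0 \<le> x\<rbrakk> \<Longrightarrow> ((\<lambda>t. z t i x) has_real_derivative
       hderiv h x - wave_speed (\<lambda>j. z t j x) i * p t i x) (at t)"
    "\<And>i. continuous_on ({0..T} \<times> {0..}) (\<lambda>(t, x). z t i x)"
    "\<And>i. continuous_on ({0..T} \<times> {0..}) (\<lambda>(t, x). p t i x)"
    "\<And>i x. 0 \<le> x \<Longrightarrow> z 0 i x = z_init i x"
proof -
  obtain A B Z P where "diagonal_system (hderiv h) (hderiv (hderiv h)) z_init p_init T A B Z P"
    using diagonal_system_exists[OF assms] .
  then interpret D: diagonal_system "hderiv h" "hderiv (hderiv h)" z_init p_init T A B Z P .
  show thesis
    by (rule that[of D.L D.z D.p D.M])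
       (use D.z_bounds D.p_bounds D.z_x_deriv D.z_t_deriv[unfolded D.G_def] D.z_continuous D.p_continuous D.z_0 in auto)
qed

end

text \<open>What follows sees only these properties of the invariants, not the scheme that produced
  them.\<close>

locale Riemann_solution = supercritical_data +
  fixes T L M :: real and z p :: "real \<Rightarrow> bool \<Rightarrow> real \<Rightarrow> real"
  assumes T: "T > 0"
    and zp_bounds: "\<And>t x i. \<lbrakk>0 \<le> t; t \<le> T; 0 \<le> x\<rbrakk> \<Longrightarrow>
      - L \<le> z t i x \<and> z t i x \<le> 0 \<and> 0 \<le> p t i x \<and> p t i x \<le> M"
    and zx: "\<And>t x i. \<lbrakk>0 \<le> t; t \<le> T; 0 \<le> x\<rbrakk> \<Longrightarrow> (z t i has_real_derivative p t i x) (at x within {0..})"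
    and zt: "\<And>t x i. \<lbrakk>0 < t; t < T; 0 \<le> x\<rbrakk> \<Longrightarrow> ((\<lambda>t. z t i x) has_real_derivative
       hderiv h x - wave_speed (\<lambda>j. z t j x) i * p t i x) (at t)"
    and z_cont: "\<And>i. continuous_on ({0..T} \<times> {0..}) (\<lambda>(t, x). z t i x)"
    and p_cont: "\<And>i. continuous_on ({0..T} \<times> {0..}) (\<lambda>(t, x). p t i x)"
    and z_0: "\<And>i x. 0 \<le> x \<Longrightarrow> z 0 i x = z_init i x"
begin

definition u where "u t x = (z t True x + z t False x) / 2"
definition c where "c t x = (z t True x - z t False x) / 4"
text \<open>With c^2 as total depth, the equations hold before the sign of c is known.\<close>

definition \<eta> where "\<eta> t x = c t x * c t x - h x"
definition ux where "ux t x = (p t True x + p t False x) / 2"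
definition cx where "cx t x = (p t True x - p t False x) / 4"
text \<open>Time derivatives read off from c_t + u c_x + c u_x / 2 = 0 and u_t + u u_x + 2 c c_x =
  h', a quarter of the difference and half the sum of the diagonal equations.\<close>

definition ct where "ct t x = - u t x * cx t x - c t x * ux t x / 2"
definition ut where "ut t x = hderiv h x - u t x * ux t x - 2 * c t x * cx t x"

lemma OmegaD: "(t, x) \<in> Omega T \<Longrightarrow> 0 < t \<and> t < T \<and> 0 \<le> x"
  by (auto simp: Omega_def)

lemma LM_nonneg: "L \<ge> 0" "M \<ge> 0"
  using zp_bounds[of 0 0 True] T by linarith+

lemma derivs_x:
  assumes "0 \<le> t" "t \<le> T" "0 \<le> x"
  shows "(u t has_real_derivative ux t x) (at x within {0..})"
    "(c t has_real_derivative cx t x) (at x within {0..})"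
    "(\<eta> t has_real_derivative 2 * c t x * cx t x - hderiv h x) (at x within {0..})"
proof -
  show u: "(u t has_real_derivative ux t x) (at x within {0..})"
    unfolding u_def ux_def by (auto intro!: derivative_eq_intros zx[OF assms])
  show c: "(c t has_real_derivative cx t x) (at x within {0..})"
    unfolding c_def cx_def by (auto intro!: derivative_eq_intros zx[OF assms])
  show "(\<eta> t has_real_derivative 2 * c t x * cx t x - hderiv h x) (at x within {0..})"
    unfolding \<eta>_def
    by (auto intro!: derivative_eq_intros c Cb_1D(1)[OF Cb_2D(1)[OF h]] assms simp: algebra_simps)
qed

lemma derivs_t:
  assumes "0 < t" "t < T" "0 \<le> x"
  shows "((\<lambda>s. u s x) has_real_derivative ut t x) (at t)"
    "((\<lambda>s. c s x) has_real_derivative ct t x) (at t)"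
    "((\<lambda>s. \<eta> s x) has_real_derivative 2 * c t x * ct t x) (at t)"
proof -
  show u: "((\<lambda>s. u s x) has_real_derivative ut t x) (at t)"
    unfolding u_def
    by (auto intro!: derivative_eq_intros zt[OF assms])
       (simp add: ut_def u_def c_def ux_def cx_def wave_speed_def field_simps)
  show c: "((\<lambda>s. c s x) has_real_derivative ct t x) (at t)"
    unfolding c_def
    by (auto intro!: derivative_eq_intros zt[OF assms])
       (simp add: ct_def u_def c_def ux_def cx_def wave_speed_def field_simps)
  show "((\<lambda>s. \<eta> s x) has_real_derivative 2 * c t x * ct t x) (at t)"
    unfolding \<eta>_def by (auto intro!: derivative_eq_intros c simp: algebra_simps)
qed

lemma continuous_fields:
  "continuous_on ({0..T} \<times> {0..}) (\<lambda>(t, x). u t x)"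
  "continuous_on ({0..T} \<times> {0..}) (\<lambda>(t, x). c t x)"
  "continuous_on ({0..T} \<times> {0..}) (\<lambda>(t, x). \<eta> t x)"
proof -
  have h: "continuous_on ({0..T} \<times> {0..}) (\<lambda>q. h (snd q))"
    by (rule continuous_on_compose2[OF Cb_1D(2)[OF Cb_2D(1)[OF h]]]) (auto intro!: continuous_intros)
  show "continuous_on ({0..T} \<times> {0..}) (\<lambda>(t, x). u t x)"
    "continuous_on ({0..T} \<times> {0..}) (\<lambda>(t, x). c t x)"
    "continuous_on ({0..T} \<times> {0..}) (\<lambda>(t, x). \<eta> t x)"
    unfolding u_def c_def \<eta>_def using z_cont[of True] z_cont[of False] h
    by (auto simp: case_prod_beta intro!: continuous_intros)
qed

lemma bounded_cont_fields:
  "bounded_cont T u" "bounded_cont T c" "bounded_cont T \<eta>" "bounded_cont T ux" "bounded_cont T cx"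
  "bounded_cont T ut" "bounded_cont T ct"
  "bounded_cont T (\<lambda>t x. hderiv h x)"
proof -
  have sub: "Omega T \<subseteq> {0..T} \<times> {0..}" by (auto simp: Omega_def)
  have z: "bounded_cont T (\<lambda>t x. z t i x)" and p: "bounded_cont T (\<lambda>t x. p t i x)" for i
  proof -
    have "\<bar>z t i x\<bar> \<le> L" "\<bar>p t i x\<bar> \<le> M" if "(t, x) \<in> Omega T" for t x
      using zp_bounds[of t x i] OmegaD[OF that] by auto
    note bounds = this
    show "bounded_cont T (\<lambda>t x. z t i x)"
      by (rule bounded_contI[OF continuous_on_subset[OF z_cont sub] bounds(1)])
    show "bounded_cont T (\<lambda>t x. p t i x)"
      by (rule bounded_contI[OF continuous_on_subset[OF p_cont sub] bounds(2)])
  qed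
  have h: "bounded_cont T (\<lambda>t x. h x)" "bounded_cont T (\<lambda>t x. hderiv h x)"
    using Cb_1D[OF Cb_2D(1)[OF h]] by (metis bounded_cont_space)+
  have half: "bounded_cont T (\<lambda>t x. f t x / k)" if "bounded_cont T f" for f k
    using bounded_cont_mult[OF that bounded_cont_const[of T "1 / k"]] by simp
  show u: "bounded_cont T u" and c: "bounded_cont T c"
    unfolding u_def[abs_def] c_def[abs_def] by (intro half bounded_cont_intros z)+
  show ux: "bounded_cont T ux" and cx: "bounded_cont T cx"
    unfolding ux_def[abs_def] cx_def[abs_def] by (intro half bounded_cont_intros p)+
  show "bounded_cont T \<eta>" unfolding \<eta>_def[abs_def] by (intro bounded_cont_intros c h)
  show "bounded_cont T ut" unfolding ut_def[abs_def] by (intro bounded_cont_intros u c ux cx h)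
  have "bounded_cont T (\<lambda>t x. 0 - u t x * cx t x - c t x * ux t x / 2)"
    by (intro half bounded_cont_intros u c ux cx)
  then show "bounded_cont T ct" unfolding ct_def[abs_def] by simp
  show "bounded_cont T (\<lambda>t x. hderiv h x)" by (rule h)
qed

lemma initial_values:
  assumes "x \<ge> 0"
  shows "u 0 x = u0 x" "c 0 x = sqrt (h x + \<eta>0 x)" "\<eta> 0 x = \<eta>0 x"
proof -
  show "u 0 x = u0 x" using z_0[OF assms] by (simp add: u_def z_init_def)
  show c: "c 0 x = sqrt (h x + \<eta>0 x)" using z_0[OF assms] by (simp add: c_def z_init_def)
  have "h x + \<eta>0 x \<ge> 0" using h_nonneg[OF assms] \<eta>0_ge[OF assms] C_pos by simp
  then show "\<eta> 0 x = \<eta>0 x" by (simp add: \<eta>_def c)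
qed

text \<open>As h + \<eta> = c^2, conservation of mass is 2 c times the equation for c, and in the
  momentum equation the slope of \<eta> is 2 c c_x - h'.\<close>

lemma solution: "shallow_water_solution h u0 \<eta>0 T u \<eta>"
  unfolding shallow_water_solution_def
proof (intro conjI)
  have d: "((\<lambda>s. u s x) has_real_derivative ut t x) (at t)"
    "(u t has_real_derivative ux t x) (at x within {0..})"
    "((\<lambda>s. \<eta> s x) has_real_derivative 2 * c t x * ct t x) (at t)"
    "(\<eta> t has_real_derivative 2 * c t x * cx t x - hderiv h x) (at x within {0..})"
    if "(t, x) \<in> Omega T" for t x
    using OmegaD[OF that] derivs_x[of t x] derivs_t[of t x] by auto
  show "u \<in> C11 T" by (rule C11I[OF d(1,2)]) (auto intro: bounded_cont_fields)
  show "\<eta> \<in> C11 T"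
    by (rule C11I[OF d(3,4)]) (auto intro!: bounded_cont_fields bounded_cont_intros)
  show "\<forall>(t, x)\<in>Omega T. pt \<eta> t x + px (\<lambda>t x. u t x * (h x + \<eta> t x)) t x = 0 \<and>
       pt u t x + u t x * px u t x + px \<eta> t x = 0"
  proof (clarify, intro conjI)
    fix t x assume tx: "(t, x) \<in> Omega T"
    note x = OmegaD[OF tx]
    have pts: "pt \<eta> t x = 2 * c t x * ct t x" "pt u t x = ut t x"
      unfolding pt_def using d[OF tx] by (auto intro: DERIV_imp_deriv)
    have pxs: "px \<eta> t x = 2 * c t x * cx t x - hderiv h x" "px u t x = ux t x"
      unfolding px_def using d[OF tx] x by (auto intro: hderiv_eq)
    have "((\<lambda>x. u t x * (h x + \<eta> t x)) has_real_derivative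
        u t x * (2 * c t x * cx t x) + ux t x * (c t x * c t x)) (at x within {0..})"
      unfolding \<eta>_def using derivs_x[of t x] x by (auto intro!: derivative_eq_intros simp: algebra_simps)
    then have "px (\<lambda>t x. u t x * (h x + \<eta> t x)) t x =
        u t x * (2 * c t x * cx t x) + ux t x * (c t x * c t x)"
      unfolding px_def using x by (intro hderiv_eq) auto
    then show "pt \<eta> t x + px (\<lambda>t x. u t x * (h x + \<eta> t x)) t x = 0"
      unfolding pts by (simp add: ct_def algebra_simps)
    show "pt u t x + u t x * px u t x + px \<eta> t x = 0"
      unfolding pts pxs by (simp add: ut_def algebra_simps)
  qed
  have sub: "{0..<T} \<times> {0..} \<subseteq> {0..T} \<times> {0::real..}" by auto
  show "has_initial_value T u u0" unfolding has_initial_value_def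
    using continuous_on_subset[OF continuous_fields(1) sub] initial_values
    by (intro exI[of _ u]) auto
  show "has_initial_value T \<eta> \<eta>0" unfolding has_initial_value_def
    using continuous_on_subset[OF continuous_fields(3) sub] initial_values
    by (intro exI[of _ \<eta>]) auto
qed

section \<open>Positivity of the depth, and uniqueness\<close>

lemma u_bounds:
  assumes "0 \<le> t" "t \<le> T" "0 \<le> x"
  shows "- L \<le> u t x" "u t x \<le> 0" "0 \<le> ux t x" "ux t x \<le> M" "\<bar>c t x\<bar> \<le> L" "\<bar>cx t x\<bar> \<le> M"
  using zp_bounds[OF assms, of True] zp_bounds[OF assms, of False] LM_nonneg
  by (auto simp: u_def ux_def c_def cx_def)

text \<open>Strict positivity of the depth follows from \<open>c\<^sub>t + u c\<^sub>x = - u\<^sub>x c / 2\<close>.\<close>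

lemma c_lower_bound:
  assumes "0 \<le> t" "t < T" "0 \<le> x"
  shows "sqrt C * exp (- M * T) \<le> c t x"
proof -
  \<comment> \<open>Initially c >= sqrt C because h >= 0, and along the velocity u it decays at rate
    at most M. Both components are the same function, since the maximum principle concerns
    pairs.\<close>
  define W where "W = (\<lambda>(i::bool) t x. sqrt C * exp (- M * t) - c t x)"
  have sC: "sqrt C > 0" using C_pos by simp
  have "W True t x \<le> 0"
  proof (rule maximum_principle[where W = W and T = t and D = "sqrt C + L" and \<Lambda> = L and K = 0])
    have "continuous_on ({0..t} \<times> {0..}) (\<lambda>(t, x). c t x)"
      by (rule continuous_on_subset[OF continuous_fields(2)]) (use assms in auto)
    then show "continuous_on ({0..t} \<times> {0..}) (\<lambda>(t, x). W i t x)" for i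
      unfolding W_def by (auto simp: case_prod_beta intro!: continuous_intros)
    show "W i s y \<le> sqrt C + L" if "0 \<le> s" "s \<le> t" "0 \<le> y" for i s y
    proof -
      have "sqrt C * exp (- M * s) \<le> sqrt C * 1" using sC that LM_nonneg by (intro mult_left_mono) auto
      then show ?thesis using u_bounds(5)[of s y] that assms by (simp add: W_def)
    qed
    show "W i 0 y \<le> 0" if "0 \<le> y" for i y
      using initial_values(2)[OF that] h_nonneg[OF that] \<eta>0_ge[OF that] by (simp add: W_def)
    show "0 \<le> L" by (rule LM_nonneg)
    fix i s y assume *: "0 < s" "s \<le> t" "0 \<le> y" "0 < W i s y"
    have s: "0 \<le> s" "s \<le> T" "s < T" using * assms by auto
    have b: "sqrt C * exp (- M * s) \<ge> 0" using sC by simp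
    have "ux s y / 2 * c s y \<le> M * (sqrt C * exp (- M * s))"
    \<comment> \<open>The sign of c is not yet known; where c is negative, its product with u_x >= 0
      is harmless.\<close>
    proof (cases "c s y \<ge> 0")
      case True
      then show ?thesis using u_bounds[OF s(1,2) *(3)] *(4) LM_nonneg
        by (intro mult_mono) (auto simp: W_def)
    next
      case False
      then have "ux s y / 2 * c s y \<le> 0" using u_bounds[OF s(1,2) *(3)] by (intro mult_nonneg_nonpos) auto
      then show ?thesis using b LM_nonneg by (smt (verit) mult_nonneg_nonneg)
    qed
    moreover have "((\<lambda>s. W i s y) has_real_derivative - (M * (sqrt C * exp (- M * s))) - ct s y) (at s)"
      unfolding W_def by (auto intro!: derivative_eq_intros derivs_t(2) * s)
    moreover have "(W i s has_real_derivative - cx s y) (at y within {0..})"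
      unfolding W_def using derivs_x(2)[OF s(1,2) *(3)] by (auto intro!: derivative_eq_intros)
    moreover have "- (M * (sqrt C * exp (- M * s))) - ct s y + u s y * (- cx s y) =
        - (M * (sqrt C * exp (- M * s))) + ux s y / 2 * c s y" by (simp add: ct_def)
    ultimately show "\<exists>Wt Wx a. ((\<lambda>s. W i s y) has_real_derivative Wt) (at s) \<and>
        (W i s has_real_derivative Wx) (at y within {0..}) \<and>
        - L \<le> a \<and> a \<le> 0 \<and> Wt + a * Wx \<le> 0 * W i s y"
      using u_bounds[OF s(1,2) *(3)] by (metis (no_types, lifting) add.commute diff_0 diff_le_0_iff_le mult_zero_left uminus_add_conv_diff)
  qed (use assms in auto)
  then have 1: "sqrt C * exp (- M * t) \<le> c t x" by (simp add: W_def)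
  have "- M * T \<le> - M * t" using assms LM_nonneg by (simp add: mult_left_mono)
  then have "sqrt C * exp (- M * T) \<le> sqrt C * exp (- M * t)" using sC by simp
  with 1 show ?thesis by linarith
qed

text \<open>Linearising the difference of two solutions around the first one, its characteristic
  variables satisfy transport equations with the characteristic speeds of the first solution.\<close>

lemma difference_transport:
  fixes v vx vt \<zeta> \<zeta>x \<zeta>t s t x :: real
  assumes s: "s = 1 \<or> s = - 1"
    and v: "vt + v * vx + \<zeta>x = 0" 
    and \<zeta>: "\<zeta>t + (v * (hderiv h x + \<zeta>x) + vx * (h x + \<zeta>)) = 0"
  defines "w \<equiv> u t x - v" and "\<phi> \<equiv> \<eta> t x - \<zeta>" and "a \<equiv> u t x + s * c t x"
  shows "(2 * c t x * ct t x - \<zeta>t + s * (ct t x * w + c t x * (ut t x - vt)))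
     + a * (2 * c t x * cx t x - hderiv h x - \<zeta>x + s * (cx t x * w + c t x * (ux t x - vx)))
    = - (w * (hderiv h x + \<zeta>x)) - \<phi> * vx - s * c t x * w * vx + w * (c t x * cx t x - s * c t x * ux t x / 2)"
proof -
  have vt: "vt = - v * vx - \<zeta>x" and \<zeta>t: "\<zeta>t = - v * (hderiv h x + \<zeta>x) - vx * (h x + \<zeta>)"
    using v \<zeta> by (simp_all add: algebra_simps)
  show ?thesis using s
    unfolding vt \<zeta>t w_def \<phi>_def a_def \<eta>_def ct_def ut_def
    by (elim disjE) (simp_all add: field_simps)
qed

text \<open>The expression is linear in w and \<phi>. The half sum and half difference of the two
  characteristic variables are \<phi> and c w, so both are bounded by \<alpha>; dividing by the
  lower bound of c then controls w.\<close>

lemma difference_bound: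
  fixes s :: real
  assumes "0 \<le> t" "t < T" "0 \<le> x" and s: "\<bar>s\<bar> = 1"
    and b: "\<bar>hderiv h x + \<zeta>x\<bar> \<le> B1" "\<bar>vx\<bar> \<le> B2"
    and \<alpha>: "\<bar>\<phi> + c t x * w\<bar> \<le> \<alpha>" "\<bar>\<phi> - c t x * w\<bar> \<le> \<alpha>"
  shows "\<bar>- (w * (hderiv h x + \<zeta>x)) - \<phi> * vx - s * c t x * w * vx + w * (c t x * cx t x - s * c t x * ux t x / 2)\<bar>
    \<le> ((B1 + L * B2 + 2 * L * M) / (sqrt C * exp (- M * T)) + B2) * \<alpha>"
proof -
  note T' = less_imp_le[OF assms(2)]
  define m where "m = sqrt C * exp (- M * T)"
  have m: "m > 0" "m \<le> c t x" using C_pos c_lower_bound[OF assms(1-3)] by (auto simp: m_def)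
  have \<phi>: "\<bar>\<phi>\<bar> \<le> \<alpha>" using \<alpha> by linarith
  have "\<bar>c t x * w\<bar> \<le> \<alpha>" using \<alpha> by linarith
  moreover have "m * \<bar>w\<bar> \<le> c t x * \<bar>w\<bar>" using m by (intro mult_right_mono) auto
  moreover have "\<bar>c t x * w\<bar> = c t x * \<bar>w\<bar>" using m by (simp add: abs_mult)
  ultimately have "m * \<bar>w\<bar> \<le> \<alpha>" by linarith
  then have w: "\<bar>w\<bar> \<le> \<alpha> / m" using m by (simp add: field_simps)
  note ub = u_bounds[OF assms(1) T' assms(3)]
  have B: "B1 \<ge> 0" "B2 \<ge> 0" "\<alpha> \<ge> 0" using b \<alpha> by linarith+
  have cw: "\<bar>s * c t x * w * vx\<bar> \<le> \<bar>w\<bar> * (L * B2)"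
  proof -
    have "\<bar>c t x\<bar> * \<bar>vx\<bar> \<le> L * B2" using ub b LM_nonneg by (intro mult_mono) auto
    then have "\<bar>w\<bar> * (\<bar>c t x\<bar> * \<bar>vx\<bar>) \<le> \<bar>w\<bar> * (L * B2)" by (intro mult_left_mono) auto
    then show ?thesis using s by (simp add: abs_mult ac_simps)
  qed
  have "\<bar>c t x * cx t x\<bar> \<le> L * M" unfolding abs_mult using ub LM_nonneg by (intro mult_mono) auto
  moreover have "\<bar>c t x * ux t x\<bar> \<le> L * M" unfolding abs_mult using ub LM_nonneg by (intro mult_mono) auto
  then have "\<bar>s * (c t x * ux t x)\<bar> \<le> L * M" unfolding abs_mult[of s] s by simp
  \<comment> \<open>L M + L M / 2, rounded up.\<close>
  ultimately have "\<bar>c t x * cx t x - s * c t x * ux t x / 2\<bar> \<le> 2 * L * M"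
    by (simp only: mult.assoc)
  then have last: "\<bar>w * (c t x * cx t x - s * c t x * ux t x / 2)\<bar> \<le> \<bar>w\<bar> * (2 * L * M)"
    unfolding abs_mult[of w] by (intro mult_left_mono) auto
  have 1: "\<bar>w * (hderiv h x + \<zeta>x)\<bar> \<le> \<bar>w\<bar> * B1" unfolding abs_mult using b by (intro mult_left_mono) auto
  have 2: "\<bar>\<phi> * vx\<bar> \<le> \<alpha> * B2" unfolding abs_mult using b \<phi> B by (intro mult_mono) auto
  have "\<bar>- (w * (hderiv h x + \<zeta>x)) - \<phi> * vx - s * c t x * w * vx + w * (c t x * cx t x - s * c t x * ux t x / 2)\<bar>
    \<le> \<bar>w\<bar> * B1 + \<alpha> * B2 + \<bar>w\<bar> * (L * B2) + \<bar>w\<bar> * (2 * L * M)"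
    using 1 2 cw last by linarith
  also have "\<dots> = \<bar>w\<bar> * (B1 + L * B2 + 2 * L * M) + B2 * \<alpha>" by (simp add: algebra_simps)
  also have "\<dots> \<le> \<alpha> / m * (B1 + L * B2 + 2 * L * M) + B2 * \<alpha>"
    using w B LM_nonneg by (intro add_right_mono mult_right_mono) auto
  also have "\<dots> = ((B1 + L * B2 + 2 * L * M) / m + B2) * \<alpha>"
    using m by (simp add: field_simps)
  finally show ?thesis by (simp add: m_def)
qed

text \<open>The characteristic variables \<open>A\<close> of the difference may have either sign, so
  the maximum principle is applied to their squares \<open>W\<close>. Where one square dominates the
  other, \<open>difference_bound\<close> limits its growth by a multiple of itself.\<close>

lemma uniqueness:
  assumes sol: "shallow_water_solution h u0 \<eta>0 T v \<zeta>" and tx0: "(t0, x0) \<in> Omega T"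
  shows "v t0 x0 = u t0 x0 \<and> \<zeta> t0 x0 = \<eta> t0 x0"
proof -
  have C11: "v \<in> C11 T" "\<zeta> \<in> C11 T" using sol by (auto simp: shallow_water_solution_def)
  obtain Bv where Bv: "\<And>t x. (t, x) \<in> Omega T \<Longrightarrow> \<bar>v t x\<bar> \<le> Bv \<and> \<bar>px v t x\<bar> \<le> Bv"
    using C11D(3)[OF C11(1)] by blast
  obtain B\<zeta> where B\<zeta>: "\<And>t x. (t, x) \<in> Omega T \<Longrightarrow> \<bar>\<zeta> t x\<bar> \<le> B\<zeta> \<and> \<bar>px \<zeta> t x\<bar> \<le> B\<zeta>"
    using C11D(3)[OF C11(2)] by blast
  obtain Bh where Bh: "\<And>x. x \<ge> 0 \<Longrightarrow> \<bar>h x\<bar> \<le> Bh \<and> \<bar>hderiv h x\<bar> \<le> Bh"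
    using Cb_1D(4)[OF Cb_2D(1)[OF h]] by blast
  have iv: "has_initial_value T v u0" "has_initial_value T \<zeta> \<eta>0"
    using sol by (auto simp: shallow_water_solution_def)
  \<comment> \<open>The value of v at t = 0 is arbitrary, so its continuous extension takes its
    place.\<close>
  obtain gv where gv': "continuous_on ({0..<T} \<times> {0..}) (\<lambda>(t, x). gv t x) \<and>
      (\<forall>(t, x) \<in> Omega T. gv t x = v t x) \<and> (\<forall>x\<ge>0. gv 0 x = u0 x)"
    using iv(1) unfolding has_initial_value_def by (elim exE) (rule that)
  obtain g\<zeta> where g\<zeta>': "continuous_on ({0..<T} \<times> {0..}) (\<lambda>(t, x). g\<zeta> t x) \<and>
      (\<forall>(t, x) \<in> Omega T. g\<zeta> t x = \<zeta> t x) \<and> (\<forall>x\<ge>0. g\<zeta> 0 x = \<eta>0 x)"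
    using iv(2) unfolding has_initial_value_def by (elim exE) (rule that)
  have gv: "continuous_on ({0..<T} \<times> {0..}) (\<lambda>(t, x). gv t x)"
    "\<And>t x. (t, x) \<in> Omega T \<Longrightarrow> gv t x = v t x" "\<And>x. x \<ge> 0 \<Longrightarrow> gv 0 x = u0 x"
    using gv' by auto
  have g\<zeta>: "continuous_on ({0..<T} \<times> {0..}) (\<lambda>(t, x). g\<zeta> t x)"
    "\<And>t x. (t, x) \<in> Omega T \<Longrightarrow> g\<zeta> t x = \<zeta> t x" "\<And>x. x \<ge> 0 \<Longrightarrow> g\<zeta> 0 x = \<eta>0 x"
    using g\<zeta>' by auto
  note tx = OmegaD[OF tx0]
  define A where "A = (\<lambda>i t x. (\<eta> t x - g\<zeta> t x) + sg i * (c t x * (u t x - gv t x)))"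
  define W where "W = (\<lambda>i t x. A i t x * A i t x)"
  define K where "K = ((Bh + B\<zeta> + L * Bv + 2 * L * M) / (sqrt C * exp (- M * T)) + Bv)"
  have init: "A i 0 x = 0" if "x \<ge> 0" for i x
    using initial_values[OF that] gv(3) g\<zeta>(3) that by (simp add: A_def)
  obtain Bu where Bu: "Bu > 0" "\<And>t x. (t, x) \<in> Omega T \<Longrightarrow> \<bar>u t x\<bar> \<le> Bu"
    using bounded_contE[OF bounded_cont_fields(1)] by blast
  obtain Be where Be: "Be > 0" "\<And>t x. (t, x) \<in> Omega T \<Longrightarrow> \<bar>\<eta> t x\<bar> \<le> Be"
    using bounded_contE[OF bounded_cont_fields(3)] by blast
  define D where "D = Be + B\<zeta> + L * (Bu + Bv)"
  have A_le: "\<bar>A i t x\<bar> \<le> D" if "(t, x) \<in> Omega T" for i t x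
  proof -
    have "\<bar>c t x * (u t x - v t x)\<bar> \<le> L * (Bu + Bv)"
      unfolding abs_mult using u_bounds(5)[of t x] OmegaD[OF that] Bu(2)[OF that] Bv[OF that] LM_nonneg
      by (intro mult_mono) auto
    then have "\<bar>sg i * (c t x * (u t x - v t x))\<bar> \<le> L * (Bu + Bv)" unfolding abs_mult[of "sg i"] by simp
    then show ?thesis using Be(2)[OF that] B\<zeta>[OF that] unfolding A_def D_def gv(2)[OF that] g\<zeta>(2)[OF that]
      by linarith
  qed
  have "W i t0 x0 \<le> 0" for i
  proof (rule maximum_principle[where W = W and T = t0 and D = "D * D" and \<Lambda> = L and K = "2 * K"])
    have sub: "{0..t0} \<times> {0..} \<subseteq> {0..T} \<times> {0::real..}" "{0..t0} \<times> {0..} \<subseteq> {0..<T} \<times> {0::real..}"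
      using tx by auto
    show "continuous_on ({0..t0} \<times> {0..}) (\<lambda>(t, x). W i t x)" for i
      unfolding W_def A_def
      using continuous_fields[THEN continuous_on_subset, OF sub(1)]
        gv(1)[THEN continuous_on_subset, OF sub(2)] g\<zeta>(1)[THEN continuous_on_subset, OF sub(2)]
      by (auto simp: case_prod_beta intro!: continuous_intros)
    show "W i t x \<le> D * D" if "0 \<le> t" "t \<le> t0" "0 \<le> x" for i t x
    proof (cases "t = 0")
      case True then show ?thesis using init[OF that(3)] by (simp add: W_def)
    next
      case False
      then have "\<bar>A i t x\<bar> \<le> D" using that tx by (intro A_le) (auto simp: Omega_def)
      then have "\<bar>A i t x\<bar> * \<bar>A i t x\<bar> \<le> D * D" by (intro mult_mono) auto
      then show ?thesis by (simp add: W_def)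
    qed
    show "W i 0 x \<le> 0" if "0 \<le> x" for i x using init[OF that] by (simp add: W_def)
    show "0 \<le> L" by (rule LM_nonneg)
    fix i t x assume *: "0 < t" "t \<le> t0" "0 \<le> x" "\<And>j. W j t x \<le> W i t x"
    have \<Omega>: "(t, x) \<in> Omega T" using * tx by (auto simp: Omega_def)
    note t = OmegaD[OF \<Omega>]
    have t': "0 \<le> t" "t \<le> T" using t by auto
    have eq: "gv t x = v t x" "g\<zeta> t x = \<zeta> t x" using gv(2) g\<zeta>(2) \<Omega> by auto
    \<comment> \<open>The extension agrees with v on the open time interval, hence has the same
      derivatives there.\<close>
    have gvt: "((\<lambda>s. gv s x) has_real_derivative pt v t x) (at t)"
      by (rule has_field_derivative_transform_within_open[OF C11D(1)[OF C11(1) \<Omega>], of "{0<..<T}"])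
         (use t gv(2) in \<open>auto simp: Omega_def\<close>)
    have g\<zeta>t: "((\<lambda>s. g\<zeta> s x) has_real_derivative pt \<zeta> t x) (at t)"
      by (rule has_field_derivative_transform_within_open[OF C11D(1)[OF C11(2) \<Omega>], of "{0<..<T}"])
         (use t g\<zeta>(2) in \<open>auto simp: Omega_def\<close>)
    have gvx: "(gv t has_real_derivative px v t x) (at x within {0..})"
      by (rule has_field_derivative_transform_within[OF C11D(2)[OF C11(1) \<Omega>], of 1])
         (use t gv(2) in \<open>auto simp: Omega_def\<close>)
    have g\<zeta>x: "(g\<zeta> t has_real_derivative px \<zeta> t x) (at x within {0..})"
      by (rule has_field_derivative_transform_within[OF C11D(2)[OF C11(2) \<Omega>], of 1])
         (use t g\<zeta>(2) in \<open>auto simp: Omega_def\<close>)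
    have "((\<lambda>y. v t y * (h y + \<zeta> t y)) has_real_derivative
        v t x * (hderiv h x + px \<zeta> t x) + px v t x * (h x + \<zeta> t x)) (at x within {0..})"
      by (auto intro!: derivative_eq_intros C11D(2)[OF C11(1) \<Omega>] C11D(2)[OF C11(2) \<Omega>]
          Cb_1D(1)[OF Cb_2D(1)[OF h]] *(3))
    then have "px (\<lambda>t x. v t x * (h x + \<zeta> t x)) t x =
        v t x * (hderiv h x + px \<zeta> t x) + px v t x * (h x + \<zeta> t x)"
      unfolding px_def[of "\<lambda>t x. v t x * (h x + \<zeta> t x)"] using *(3) by (intro hderiv_eq) auto
    then have pde: "pt v t x + v t x * px v t x + px \<zeta> t x = 0"
      "pt \<zeta> t x + (v t x * (hderiv h x + px \<zeta> t x) + px v t x * (h x + \<zeta> t x)) = 0"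
      using sol \<Omega> unfolding shallow_water_solution_def by auto
    define w where "w = u t x - v t x"
    define \<phi> where "\<phi> = \<eta> t x - \<zeta> t x"
    have Aeq: "A j t x = \<phi> + sg j * (c t x * w)" for j by (simp add: A_def eq w_def \<phi>_def)
    define At where "At = 2 * c t x * ct t x - pt \<zeta> t x + sg i * (ct t x * w + c t x * (ut t x - pt v t x))"
    define Ax where "Ax = 2 * c t x * cx t x - hderiv h x - px \<zeta> t x + sg i * (cx t x * w + c t x * (ux t x - px v t x))"
    define a where "a = u t x + sg i * c t x"
    have dAt: "((\<lambda>s. A i s x) has_real_derivative At) (at t)"
      unfolding A_def At_def w_def using derivs_t[of t x] t gvt g\<zeta>t
      by (auto intro!: derivative_eq_intros simp: eq algebra_simps)
    have dAx: "(A i t has_real_derivative Ax) (at x within {0..})"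
      unfolding A_def Ax_def w_def using derivs_x[OF t'] t gvx g\<zeta>x
      by (auto intro!: derivative_eq_intros simp: eq algebra_simps)
    have dWt: "((\<lambda>s. W i s x) has_real_derivative 2 * A i t x * At) (at t)"
      unfolding W_def by (auto intro!: derivative_eq_intros dAt)
    have dWx: "(W i t has_real_derivative 2 * A i t x * Ax) (at x within {0..})"
      unfolding W_def by (auto intro!: derivative_eq_intros dAx)
    \<comment> \<open>The larger square belongs to the larger modulus, which can then serve as
      \<alpha> in \<open>difference_bound\<close>.\<close>
    have "\<bar>A j t x\<bar> \<le> \<bar>A i t x\<bar>" for j
      using *(4)[of j] unfolding W_def power2_eq_square[symmetric] by (simp add: abs_le_square_iff)
    from this[of True] this[of False]
    have dom: "\<bar>\<phi> + c t x * w\<bar> \<le> \<bar>A i t x\<bar>" "\<bar>\<phi> - c t x * w\<bar> \<le> \<bar>A i t x\<bar>"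
      unfolding Aeq[of True] Aeq[of False] by simp_all
    have bounds: "\<bar>hderiv h x + px \<zeta> t x\<bar> \<le> Bh + B\<zeta>" "\<bar>px v t x\<bar> \<le> Bv" "\<bar>sg i\<bar> = 1" "0 \<le> t" "t < T"
      using Bh[OF *(3)] B\<zeta>[OF \<Omega>] Bv[OF \<Omega>] t by auto
    have sgi: "sg i = 1 \<or> sg i = - 1" by (simp add: sg_def)
    have "\<bar>At + a * Ax\<bar> \<le> K * \<bar>A i t x\<bar>"
      unfolding At_def Ax_def a_def w_def K_def
      unfolding difference_transport[OF sgi pde]
      by (rule difference_bound[OF bounds(4,5) *(3) bounds(3,1,2) dom[unfolded w_def \<phi>_def]])
    then have "\<bar>A i t x\<bar> * \<bar>At + a * Ax\<bar> \<le> \<bar>A i t x\<bar> * (K * \<bar>A i t x\<bar>)"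
      by (intro mult_left_mono) auto
    then have "\<bar>A i t x * (At + a * Ax)\<bar> \<le> K * W i t x"
      by (simp add: abs_mult W_def ac_simps abs_mult_self_eq)
    then have "2 * A i t x * At + a * (2 * A i t x * Ax) \<le> 2 * K * W i t x"
      by (simp add: algebra_simps abs_le_iff)
    \<comment> \<open>The speed is that of the constructed solution, a weighted mean of invariants
      lying in [-L, 0].\<close>
    moreover have "a = wave_speed (\<lambda>j. z t j x) i"
      by (cases i) (simp_all add: a_def u_def c_def wave_speed_def field_simps)
    then have "- L \<le> a" "a \<le> 0"
      using zp_bounds[OF t' *(3)] by (auto intro: wave_speed_ge wave_speed_le)
    ultimately show "\<exists>Wt Wx a. ((\<lambda>s. W i s x) has_real_derivative Wt) (at t) \<and>
        (W i t has_real_derivative Wx) (at x within {0..}) \<and>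
        - L \<le> a \<and> a \<le> 0 \<and> Wt + a * Wx \<le> 2 * K * W i t x"
      using dWt dWx by blast
  qed (use tx in auto)
  then have "A i t0 x0 = 0" for i
    unfolding W_def by (metis mult_eq_0_iff not_real_square_gt_zero order_antisym_conv zero_le_square)
  from this[of True] this[of False]
  have "\<eta> t0 x0 - \<zeta> t0 x0 = 0" "c t0 x0 * (u t0 x0 - v t0 x0) = 0"
    unfolding A_def gv(2)[OF tx0] g\<zeta>(2)[OF tx0] by simp_all
  moreover have "c t0 x0 > 0"
    using c_lower_bound[of t0 x0] tx C_pos by (smt (verit) exp_gt_zero mult_pos_pos real_sqrt_gt_zero)
  ultimately show ?thesis by auto
qed

end

theorem theorem2:
  fixes u0 \<eta>0 h :: "real \<Rightarrow> real" and C :: real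
  assumes "u0 \<in> Cb 1" and "\<eta>0 \<in> Cb 1" and "h \<in> Cb 2"
    and "\<And>x. x \<ge> 0 \<Longrightarrow> h x \<ge> 0"
    and "\<And>x. x \<ge> 0 \<Longrightarrow> hderiv h x \<le> 0"
    and "\<And>x. x \<ge> 0 \<Longrightarrow> hderiv (hderiv h) x \<ge> 0"
    and "C > 0"
    and "\<And>x. x \<ge> 0 \<Longrightarrow> \<eta>0 x \<ge> C"
    and "\<And>x. x \<ge> 0 \<Longrightarrow> u0 x \<le> - 2 * sqrt (h x + \<eta>0 x)"
    and "\<And>x. x \<ge> 0 \<Longrightarrow>
           hderiv u0 x \<ge> \<bar>hderiv h x + hderiv \<eta>0 x\<bar> / sqrt (h x + \<eta>0 x)"
  shows "\<forall>T>0. \<exists>u \<eta>. shallow_water_solution h u0 \<eta>0 T u \<eta> \<and>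
           (\<forall>v \<zeta>. shallow_water_solution h u0 \<eta>0 T v \<zeta> \<longrightarrow>
              (\<forall>(t, x) \<in> Omega T. v t x = u t x \<and> \<zeta> t x = \<eta> t x))"
proof (intro allI impI)
  fix T :: real assume T: "T > 0"
  interpret supercritical_data u0 \<eta>0 h C by unfold_locales (fact assms)+
  obtain z p :: "real \<Rightarrow> bool \<Rightarrow> real \<Rightarrow> real" and L M where
    zp: "\<And>t x i. \<lbrakk>0 \<le> t; t \<le> T; 0 \<le> x\<rbrakk> \<Longrightarrow> - L \<le> z t i x \<and> z t i x \<le> 0 \<and> 0 \<le> p t i x \<and> p t i x \<le> M"
    "\<And>t x i. \<lbrakk>0 \<le> t; t \<le> T; 0 \<le> x\<rbrakk> \<Longrightarrow> (z t i has_real_derivative p t i x) (at x within {0..})"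
    "\<And>t x i. \<lbrakk>0 < t; t < T; 0 \<le> x\<rbrakk> \<Longrightarrow> ((\<lambda>t. z t i x) has_real_derivative
       hderiv h x - wave_speed (\<lambda>j. z t j x) i * p t i x) (at t)"
    "\<And>i. continuous_on ({0..T} \<times> {0..}) (\<lambda>(t, x). z t i x)"
    "\<And>i. continuous_on ({0..T} \<times> {0..}) (\<lambda>(t, x). p t i x)"
    "\<And>i x. 0 \<le> x \<Longrightarrow> z 0 i x = z_init i x"
    by (rule Riemann_invariants[OF T]) (rule that; assumption)
  interpret R: Riemann_solution u0 \<eta>0 h C T L M z p by unfold_locales (fact T zp)+
  show "\<exists>u \<eta>. shallow_water_solution h u0 \<eta>0 T u \<eta> \<and>
           (\<forall>v \<zeta>. shallow_water_solution h u0 \<eta>0 T v \<zeta> \<longrightarrow>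
              (\<forall>(t, x) \<in> Omega T. v t x = u t x \<and> \<zeta> t x = \<eta> t x))"
    using R.solution R.uniqueness by blast
qed

end
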